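(* Let $k\ge1$ and $l\ge 1$ be integers. For the Gauss–Rényi random map, in which at each step the Gauss map $T_0$ is applied with probability $1-\epsilon$ and the Rényi map $T_1$ with probability $\epsilon$, independently, let $L_\epsilon=(1-\epsilon)L_0+\epsilon L_1$ be the annealed transfer operator and $h_\epsilon$ the invariant density. Then, as $\epsilon\to0$, $$h_\epsilon=h_0+\sum_{n=1}^k\frac{\epsilon^n}{(n-1)!}\,\partial_\epsilon^{n-1}(I-L_\epsilon)^{-1}\left[L_1h_0-h_0\right]\Big|_{\epsilon=0}+o(\epsilon^k)$$ in $C^l([0,1])$.
   Context: The Gauss map and the Rényi map on $[0,1]$ are $T_0(x)=\frac1x-\lfloor\frac1x\rfloor$, with $T_0(0)=0$, and $T_1(x)=\frac{1}{1-x}-\lfloor\frac{1}{1-x}\rfloor$, with $T_1(1)=0$. For $i\in\{0,1\}$, $L_i$ is the transfer operator of $T_i$ (with respect to Lebesgue measure), $L_i f=\sum_{a\ge1}|(V^i_a)'|\,f\circ V^i_a$, where $V^i_a$ is the inverse of the $a$-th branch of $T_i$, that is $V^0_a(x)=\frac{1}{a+x}$ and $V^1_a(x)=1-\frac1{a+x}$. For $\epsilon\ge0$ small, $L_\epsilon=(1-\epsilon)L_0+\epsilon L_1$ acts on $C^l([0,1])$. The invariant density $h_\epsilon\in C^l([0,1])$ is the unique probability density with $L_\epsilon h_\epsilon=h_\epsilon$ (so $h_0(x)=\frac{1}{\log 2\,(1+x)}$ is the Gauss density). $(I-L_\epsilon)^{-1}$ denotes the inverse of $I-L_\epsilon$ on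 the space of functions in $C^l([0,1])$ with zero Lebesgue average; $L_1h_0-h_0$ belongs to this space. Derivatives in $\epsilon$ at $\epsilon=0$ are (one-sided) derivatives of $C^l([0,1])$-valued maps, and $o(\epsilon^k)$ is with respect to the $C^l$ norm. *)

theory Defs
  imports "HOL-Analysis.Analysis" "HOL-Library.Landau_Symbols"
begin

definition gauss_map :: "real \<Rightarrow> real" where
  "gauss_map x = (if x = 0 then 0 else 1 / x - of_int \<lfloor>1 / x\<rfloor>)"

definition renyi_map :: "real \<Rightarrow> real" where
  "renyi_map x = (if x = 1 then 0 else 1 / (1 - x) - of_int \<lfloor>1 / (1 - x)\<rfloor>)"

definition gauss_inv_branch :: "nat \<Rightarrow> real \<Rightarrow> real" where
  "gauss_inv_branch a x = 1 / (real a + x)"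

definition renyi_inv_branch :: "nat \<Rightarrow> real \<Rightarrow> real" where
  "renyi_inv_branch a x = 1 - 1 / (real a + x)"

text \<open>
  The full branches of the Gauss map are \<open>(1/(a+1), 1/a] \<rightarrow> [0,1)\<close>, those of the Renyi map are
  \<open>[1 - 1/a, 1 - 1/(a+1)) \<rightarrow> [0,1)\<close>, for \<open>a \<ge> 1\<close>.  The next two lemmas record that the explicit
  formulas above are the inverses of these branches; at \<open>x = 1\<close> they are the continuous extensions.
\<close>

lemma gauss_inv_branch_inverse:
  assumes "a \<ge> 1"
  shows "bij_betw (gauss_inv_branch a) {0..<1} {1 / (real a + 1) <.. 1 / real a}"
    and "x \<in> {0..<1} \<Longrightarrow> gauss_map (gauss_inv_branch a x) = x"
    and "y \<in> {1 / (real a + 1) <.. 1 / real a} \<Longrightarrow> gauss_inv_branch a (gauss_map y) = y"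
proof -
  have a: "real a > 0" using assms by simp
  have fwd: "gauss_inv_branch a x \<in> {1 / (real a + 1) <.. 1 / real a} \<and>
      gauss_map (gauss_inv_branch a x) = x" if x: "x \<in> {0..<1}" for x
  proof -
    have "\<lfloor>real a + x\<rfloor> = int a" using x by (auto simp: floor_eq_iff)
    thus ?thesis using x a
      by (auto simp: gauss_inv_branch_def gauss_map_def intro!: divide_strict_left_mono divide_left_mono)
  qed
  have bwd: "gauss_map y \<in> {0..<1} \<and> gauss_inv_branch a (gauss_map y) = y"
    if y: "y \<in> {1 / (real a + 1) <.. 1 / real a}" for y
  proof -
    have y0: "y > 0" using y a by (auto intro: less_trans[rotated])
    have "\<lfloor>1 / y\<rfloor> = int a" using y a y0 by (auto simp: floor_eq_iff field_simps)
    moreover have "real a \<le> 1 / y" "1 / y < real a + 1" using y a y0 by (auto simp: field_simps)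
    ultimately show ?thesis using y0 by (auto simp: gauss_inv_branch_def gauss_map_def)
  qed
  show "bij_betw (gauss_inv_branch a) {0..<1} {1 / (real a + 1) <.. 1 / real a}"
    by (rule bij_betw_byWitness[where f' = gauss_map]) (use fwd bwd in auto)
  show "x \<in> {0..<1} \<Longrightarrow> gauss_map (gauss_inv_branch a x) = x" using fwd by blast
  show "y \<in> {1 / (real a + 1) <.. 1 / real a} \<Longrightarrow> gauss_inv_branch a (gauss_map y) = y"
    using bwd by blast
qed

lemma renyi_inv_branch_inverse:
  assumes "a \<ge> 1"
  shows "bij_betw (renyi_inv_branch a) {0..<1} {1 - 1 / real a ..< 1 - 1 / (real a + 1)}"
    and "x \<in> {0..<1} \<Longrightarrow> renyi_map (renyi_inv_branch a x) = x"
    and "y \<in> {1 - 1 / real a ..< 1 - 1 / (real a + 1)} \<Longrightarrow> renyi_inv_branch a (renyi_map y) = y"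
proof -
  have eq: "renyi_map z = gauss_map (1 - z)" "renyi_inv_branch a z = 1 - gauss_inv_branch a z" for z
    by (auto simp: renyi_map_def gauss_map_def renyi_inv_branch_def gauss_inv_branch_def)
  note g = gauss_inv_branch_inverse[OF assms]
  have fwd: "gauss_inv_branch a x \<in> {1 / (real a + 1) <.. 1 / real a}" if "x \<in> {0..<1}" for x
    using bij_betwE[OF g(1)] that by blast
  have bwd: "gauss_map y \<in> {0..<1}" for y
    unfolding gauss_map_def using frac_ge_0[of "1 / y"] frac_lt_1[of "1 / y"] by (auto simp: frac_def)
  show R: "x \<in> {0..<1} \<Longrightarrow> renyi_map (renyi_inv_branch a x) = x" for x
    using g(2) by (simp add: eq)
  show L: "y \<in> {1 - 1 / real a ..< 1 - 1 / (real a + 1)} \<Longrightarrow> renyi_inv_branch a (renyi_map y) = y"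
    for y
    using g(3)[of "1 - y"] by (auto simp: eq)
  show "bij_betw (renyi_inv_branch a) {0..<1} {1 - 1 / real a ..< 1 - 1 / (real a + 1)}"
  proof (rule bij_betw_byWitness[where f' = renyi_map])
    show "renyi_inv_branch a ` {0..<1} \<subseteq> {1 - 1 / real a ..< 1 - 1 / (real a + 1)}"
      using fwd by (force simp: eq)
    show "renyi_map ` {1 - 1 / real a ..< 1 - 1 / (real a + 1)} \<subseteq> {0..<1}"
      using bwd by (auto simp: eq(1) simp del: atLeastLessThan_iff)
  qed (use L R in blast)+
qed

text \<open>
  A function on \<open>[0,1]\<close> is represented by the function on the whole real line that is \<open>0\<close> outside
  \<open>[0,1]\<close>; so \<open>C_space l\<close> is a linear subspace of \<open>real \<Rightarrow> real\<close>, and equality of its elements is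
  equality on \<open>[0,1]\<close>.  All derivatives are taken within \<open>[0,1]\<close>, hence one-sided at the end points
  and independent of the values outside.
\<close>

definition D01 :: "(real \<Rightarrow> real) \<Rightarrow> real \<Rightarrow> real" where
  "D01 f x = vector_derivative f (at x within {0..1})"

definition C_space :: "nat \<Rightarrow> (real \<Rightarrow> real) set" where
  "C_space l = {f. (\<forall>x. x \<notin> {0..1} \<longrightarrow> f x = 0) \<and>
     (\<forall>j<l. (D01 ^^ j) f differentiable_on {0..1}) \<and>
     continuous_on {0..1} ((D01 ^^ l) f)}"

definition C_norm :: "nat \<Rightarrow> (real \<Rightarrow> real) \<Rightarrow> real" where
  "C_norm l f = (\<Sum>j\<le>l. SUP x\<in>{0..1}. \<bar>(D01 ^^ j) f x\<bar>)"

definition C_space0 :: "nat \<Rightarrow> (real \<Rightarrow> real) set" where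
  "C_space0 l = {f \<in> C_space l. integral {0..1} f = 0}"

definition transfer :: "(nat \<Rightarrow> real \<Rightarrow> real) \<Rightarrow> (real \<Rightarrow> real) \<Rightarrow> real \<Rightarrow> real" where
  "transfer V f x =
     (if x \<in> {0..1} then \<Sum>\<^sub>\<infinity>a\<in>{1..}. \<bar>deriv (V a) x\<bar> * f (V a x) else 0)"

definition L0 :: "(real \<Rightarrow> real) \<Rightarrow> real \<Rightarrow> real" where
  "L0 = transfer gauss_inv_branch"

definition L1 :: "(real \<Rightarrow> real) \<Rightarrow> real \<Rightarrow> real" where
  "L1 = transfer renyi_inv_branch"

definition annealed :: "real \<Rightarrow> (real \<Rightarrow> real) \<Rightarrow> real \<Rightarrow> real" where
  "annealed \<epsilon> f = (\<lambda>x. (1 - \<epsilon>) * L0 f x + \<epsilon> * L1 f x)"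

definition is_invariant_density :: "nat \<Rightarrow> real \<Rightarrow> (real \<Rightarrow> real) \<Rightarrow> bool" where
  "is_invariant_density l \<epsilon> h \<longleftrightarrow>
     h \<in> C_space l \<and> (\<forall>x\<in>{0..1}. h x \<ge> 0) \<and> integral {0..1} h = 1 \<and> annealed \<epsilon> h = h"

definition invariant_density :: "nat \<Rightarrow> real \<Rightarrow> real \<Rightarrow> real" where
  "invariant_density l \<epsilon> = (THE h. is_invariant_density l \<epsilon> h)"

definition I_minus_L :: "real \<Rightarrow> (real \<Rightarrow> real) \<Rightarrow> real \<Rightarrow> real" where
  "I_minus_L \<epsilon> f = (\<lambda>x. f x - annealed \<epsilon> f x)"

definition I_minus_L_inv :: "nat \<Rightarrow> real \<Rightarrow> (real \<Rightarrow> real) \<Rightarrow> real \<Rightarrow> real" where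
  "I_minus_L_inv l \<epsilon> = the_inv_into (C_space0 l) (I_minus_L \<epsilon>)"

text \<open>
  The parameter ranges over \<open>[0,\<infinity>)\<close>: the derivative at \<open>0\<close> is one-sided, at \<open>s > 0\<close> two-sided.
  Only the germ of \<open>\<phi>\<close> at \<open>s\<close> within \<open>[0,\<infinity>)\<close> matters.
\<close>

definition has_C_derivative ::
    "nat \<Rightarrow> (real \<Rightarrow> real \<Rightarrow> real) \<Rightarrow> (real \<Rightarrow> real) \<Rightarrow> real \<Rightarrow> bool" where
  "has_C_derivative l \<phi> \<psi> s \<longleftrightarrow>
     \<psi> \<in> C_space l \<and> \<phi> s \<in> C_space l \<and> (\<forall>\<^sub>F t in at s within {0..}. \<phi> t \<in> C_space l) \<and>
     ((\<lambda>t. C_norm l (\<lambda>x. (\<phi> t x - \<phi> s x) / (t - s) - \<psi> x)) \<longlongrightarrow> 0) (at s within {0..})"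

definition C_deriv :: "nat \<Rightarrow> (real \<Rightarrow> real \<Rightarrow> real) \<Rightarrow> real \<Rightarrow> real \<Rightarrow> real" where
  "C_deriv l \<phi> s = (THE \<psi>. has_C_derivative l \<phi> \<psi> s)"

end

theory Submission imports Defs "HOL-Library.Function_Algebras" begin

text \<open>
  Write \<open>Q\<^sub>\<epsilon>\<close> for the inverse of \<open>I - L\<^sub>\<epsilon>\<close> on the functions of zero average, \<open>P = L\<^sub>1 - L\<^sub>0\<close> and
  \<open>v = L\<^sub>1 h\<^sub>0 - h\<^sub>0\<close>.  Since \<open>L\<^sub>0 h\<^sub>0 = h\<^sub>0\<close>, one has \<open>L\<^sub>\<epsilon> h\<^sub>0 - h\<^sub>0 = \<epsilon> v\<close>, so that
  \<open>(I - L\<^sub>\<epsilon>) (h\<^sub>\<epsilon> - h\<^sub>0) = \<epsilon> v\<close> and hence \<open>h\<^sub>\<epsilon> = h\<^sub>0 + \<epsilon> Q\<^sub>\<epsilon> v\<close>.  As \<open>L\<^sub>\<epsilon> = L\<^sub>0 + \<epsilon> P\<close> is affine in \<open>\<epsilon>\<close>,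
  the resolvent identity \<open>Q\<^sub>t = Q\<^sub>s + (t - s) Q\<^sub>t P Q\<^sub>s\<close> can be iterated: \<open>Q\<^sub>t v\<close> has the Taylor
  coefficients \<open>(Q\<^sub>s P)\<^sup>n Q\<^sub>s v\<close> at \<open>s\<close>, with an explicit remainder (\<open>W_Taylor\<close>), and its \<open>n\<close>-th
  derivative at \<open>s\<close> is \<open>n!\<close> times the \<open>n\<close>-th coefficient (\<open>W_derivative\<close>).  The expansion of
  \<open>h\<^sub>\<epsilon>\<close> is the one of \<open>Q\<^sub>\<epsilon> v\<close> at \<open>s = 0\<close>, multiplied by \<open>\<epsilon>\<close>.

  All this rests on the invertibility of \<open>I - L\<^sub>\<epsilon>\<close> on the functions of zero average in \<open>C\<^sup>l\<close>,
  uniformly in small \<open>\<epsilon>\<close>.  It follows from a Neumann series once \<open>L\<^sub>0\<close> is a strict contraction in a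
  norm equivalent to the one of \<open>C\<^sup>l\<close>, for then \<open>L\<^sub>\<epsilon>\<close> is one too.  Such a norm is built
  from below (\<open>adapted_norm_exists\<close>).  For \<open>l = 1\<close> it is the supremum of the derivative of
  \<open>(1 + x) f(x)\<close>, which \<open>L\<^sub>0\<close> contracts by \<open>7 / 8\<close> (\<open>gauss_deriv_contraction\<close>, the argument of
  Kuzmin and Szusz).  For the step to \<open>l + 1\<close>, the sums over branches
  \<open>\<Sum>\<^sub>n (n + 1 + x)\<^sup>-\<^sup>s f(1 / (n + 1 + x))\<close> form a family closed under differentiation, so that the
  leading term of the derivative of order \<open>l + 1\<close> of \<open>L\<^sub>0 f\<close> is explicit.  It is contracted by
  \<open>5 / 8\<close> in the supremum norm with weight \<open>1 + x\<close>, and the other terms are bounded by the norm of \<open>C\<^sup>l\<close>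
  (\<open>weighted_top_L0\<close>); a small multiple of the weighted supremum is therefore added to the norm
  constructed before.

  The operator \<open>L\<^sub>1\<close> only needs to be bounded; it is \<open>L\<^sub>0\<close> after the reflection \<open>x \<mapsto> 1 - x\<close>.
\<close>

section \<open>Perturbation of a contraction\<close>

text \<open>The space is a subspace \<open>S\<close> of a larger vector space, as \<open>C\<^sup>l([0,1])\<close> is one of all functions on
  the real line.  Completeness is stated for absolutely convergent series, because these can be
  differentiated termwise in \<open>C\<^sup>l\<close> and because the Neumann series is of this kind.\<close>

locale perturbed_contraction =
  fixes S :: "'a::real_vector set" and N :: "'a \<Rightarrow> real" and A B :: "'a \<Rightarrow> 'a" and q K :: real
  assumes S: "subspace S"
    and N_add: "f \<in> S \<Longrightarrow> g \<in> S \<Longrightarrow> N (f + g) \<le> N f + N g"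
    and N_scale: "f \<in> S \<Longrightarrow> N (c *\<^sub>R f) = \<bar>c\<bar> * N f"
    and N_eq_0: "f \<in> S \<Longrightarrow> N f = 0 \<Longrightarrow> f = 0"
    and complete: "(\<And>n. u n \<in> S) \<Longrightarrow> summable (\<lambda>n. N (u n)) \<Longrightarrow>
        \<exists>s\<in>S. (\<lambda>n. N (s - (\<Sum>i<n. u i))) \<longlonglongrightarrow> 0"
    and A_in: "f \<in> S \<Longrightarrow> A f \<in> S" and B_in: "f \<in> S \<Longrightarrow> B f \<in> S"
    and A_add: "f \<in> S \<Longrightarrow> g \<in> S \<Longrightarrow> A (f + g) = A f + A g"
    and B_add: "f \<in> S \<Longrightarrow> g \<in> S \<Longrightarrow> B (f + g) = B f + B g"
    and A_scale: "f \<in> S \<Longrightarrow> A (c *\<^sub>R f) = c *\<^sub>R A f"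
    and B_scale: "f \<in> S \<Longrightarrow> B (c *\<^sub>R f) = c *\<^sub>R B f"
    and A_contr: "f \<in> S \<Longrightarrow> N (A f) \<le> q * N f"
    and B_bound: "f \<in> S \<Longrightarrow> N (B f) \<le> K * N f"
    and q: "0 \<le> q" "q < 1" and K: "0 \<le> K"
begin

lemmas S_rules = subspace_add[OF S] subspace_diff[OF S] subspace_scale[OF S] subspace_0[OF S]

lemma N_0: "N 0 = 0"
  using N_scale[OF subspace_0[OF S], of 0] by simp

lemma N_minus: "f \<in> S \<Longrightarrow> g \<in> S \<Longrightarrow> N (f - g) \<le> N f + N g"
  using N_add[of f "(-1) *\<^sub>R g"] N_scale[of g "-1"] S_rules(3)[of g "-1"] by simp

lemma N_nonneg: "f \<in> S \<Longrightarrow> 0 \<le> N f"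
  using N_minus[of f f] N_0 by simp

text \<open>The perturbation direction is \<open>P\<close>: the family is affine, \<open>T \<epsilon> = A + \<epsilon> P\<close>.\<close>

definition T :: "real \<Rightarrow> 'a \<Rightarrow> 'a" where
  "T \<epsilon> f = (1 - \<epsilon>) *\<^sub>R A f + \<epsilon> *\<^sub>R B f"

definition P :: "'a \<Rightarrow> 'a" where
  "P f = B f - A f"

definition Q :: "real \<Rightarrow> 'a \<Rightarrow> 'a" where
  "Q \<epsilon> = the_inv_into S (\<lambda>f. f - T \<epsilon> f)"

text \<open>For parameters up to this threshold all the operators \<open>T \<epsilon>\<close> contract by the common
  factor \<open>(1 + q) / 2\<close>.\<close>

definition threshold :: real where
  "threshold = (1 - q) / 2 / (K + 1)"

definition rate :: real where
  "rate = (1 + q) / 2"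

lemma rate: "0 \<le> rate" "rate < 1" and threshold: "0 < threshold" "threshold \<le> 1 / 2"
proof -
  show "0 \<le> rate" "rate < 1" using q by (auto simp: rate_def)
  show "0 < threshold" using q K by (auto simp: threshold_def)
  have "(1 - q) * 1 \<le> 1 * (K + 1)" using q K by (intro mult_mono) auto
  thus "threshold \<le> 1 / 2" using K by (simp add: threshold_def divide_le_eq)
qed

lemma T_in: "f \<in> S \<Longrightarrow> T \<epsilon> f \<in> S"
  unfolding T_def by (intro S_rules A_in B_in)

lemma P_in: "f \<in> S \<Longrightarrow> P f \<in> S"
  unfolding P_def by (intro S_rules A_in B_in)

lemma T_add: "f \<in> S \<Longrightarrow> g \<in> S \<Longrightarrow> T \<epsilon> (f + g) = T \<epsilon> f + T \<epsilon> g"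
  by (simp add: T_def A_add B_add algebra_simps)

lemma T_scale: "f \<in> S \<Longrightarrow> T \<epsilon> (c *\<^sub>R f) = c *\<^sub>R T \<epsilon> f"
  by (simp add: T_def A_scale B_scale algebra_simps)

lemma T_diff: "f \<in> S \<Longrightarrow> g \<in> S \<Longrightarrow> T \<epsilon> (f - g) = T \<epsilon> f - T \<epsilon> g"
  using T_add[of f "(-1) *\<^sub>R g" \<epsilon>] T_scale[of g \<epsilon> "-1"] S_rules(3)[of g "-1"] by simp

lemma P_add: "f \<in> S \<Longrightarrow> g \<in> S \<Longrightarrow> P (f + g) = P f + P g"
  by (simp add: P_def A_add B_add algebra_simps)

lemma P_scale: "f \<in> S \<Longrightarrow> P (c *\<^sub>R f) = c *\<^sub>R P f"
  by (simp add: P_def A_scale B_scale algebra_simps)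

lemma P_bound: "f \<in> S \<Longrightarrow> N (P f) \<le> (K + q) * N f"
  using N_minus[OF B_in A_in, of f f] A_contr[of f] B_bound[of f]
  by (simp add: P_def algebra_simps)

lemma T_contr:
  assumes "f \<in> S" "\<epsilon> \<in> {0..threshold}"
  shows "N (T \<epsilon> f) \<le> rate * N f"
proof -
  have \<epsilon>: "0 \<le> \<epsilon>" "\<epsilon> \<le> 1" using assms threshold by auto
  have "N (T \<epsilon> f) \<le> N ((1 - \<epsilon>) *\<^sub>R A f) + N (\<epsilon> *\<^sub>R B f)"
    unfolding T_def by (intro N_add S_rules A_in B_in assms)
  also have "\<dots> = (1 - \<epsilon>) * N (A f) + \<epsilon> * N (B f)"
    using \<epsilon> by (simp add: N_scale A_in B_in assms)
  also have "\<dots> \<le> 1 * (q * N f) + threshold * (K * N f)"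
    using assms \<epsilon> q K
    by (intro add_mono mult_mono A_contr B_bound) (auto intro!: N_nonneg A_in B_in mult_nonneg_nonneg)
  also have "\<dots> = (q + threshold * K) * N f" by (simp add: algebra_simps)
  also have "threshold * K \<le> threshold * (K + 1)" using threshold by (intro mult_left_mono) auto
  also have "threshold * (K + 1) = (1 - q) / 2"
    using K by (simp add: threshold_def nonzero_divide_eq_eq del: distrib_left)
  also have "q + (1 - q) / 2 = rate" by (simp add: rate_def field_simps)
  finally show ?thesis using assms by (simp add: mult_right_mono N_nonneg)
qed

lemma fixed_point_trivial:
  assumes "f \<in> S" "\<epsilon> \<in> {0..threshold}" "T \<epsilon> f = f"
  shows "f = 0"
proof (rule N_eq_0[OF assms(1)])
  have "(1 - rate) * N f \<le> 0" using T_contr[OF assms(1,2)] assms(3) by (simp add: algebra_simps)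
  thus "N f = 0" using N_nonneg[OF assms(1)] rate by (simp add: mult_le_0_iff)
qed

text \<open>Surjectivity is the Neumann series.\<close>

lemma bij_I_minus_T:
  assumes \<epsilon>: "\<epsilon> \<in> {0..threshold}"
  shows "bij_betw (\<lambda>f. f - T \<epsilon> f) S S"
  unfolding bij_betw_def
proof (intro conjI inj_onI subset_antisym subsetI)
  fix f g assume fg: "f \<in> S" "g \<in> S" "f - T \<epsilon> f = g - T \<epsilon> g"
  have "T \<epsilon> (f - g) = f - g" using fg by (simp add: T_diff algebra_simps)
  thus "f = g" using fixed_point_trivial[OF _ \<epsilon>, of "f - g"] fg by (simp add: S_rules)
next
  fix g assume "g \<in> (\<lambda>f. f - T \<epsilon> f) ` S"
  thus "g \<in> S" by (auto intro!: S_rules T_in)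
next
  fix g assume g: "g \<in> S"
  define u where "u n = (T \<epsilon> ^^ n) g" for n
  have u_in: "u n \<in> S" for n by (induction n) (auto simp: u_def g T_in)
  have u_Suc: "u (Suc n) = T \<epsilon> (u n)" for n by (simp add: u_def)
  have u_le: "N (u n) \<le> rate ^ n * N g" for n
  proof (induction n)
    case (Suc n)
    have "N (u (Suc n)) \<le> rate * N (u n)" unfolding u_Suc by (rule T_contr[OF u_in \<epsilon>])
    also have "\<dots> \<le> rate * (rate ^ n * N g)" using rate Suc by (intro mult_left_mono) auto
    finally show ?case by simp
  qed (simp add: u_def)
  have lim: "(\<lambda>n. rate ^ n * N g) \<longlonglongrightarrow> 0"
    using rate by (intro tendsto_mult_left_zero LIMSEQ_power_zero) auto
  have "summable (\<lambda>n. rate ^ n * N g)" using rate by (intro summable_mult2 summable_geometric) auto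
  hence "summable (\<lambda>n. N (u n))"
    by (rule summable_comparison_test') (use u_le N_nonneg[OF u_in] in auto)
  with complete u_in obtain s where s: "s \<in> S" "(\<lambda>n. N (s - (\<Sum>i<n. u i))) \<longlonglongrightarrow> 0" by blast
  define p where "p n = (\<Sum>i<n. u i)" for n
  have p_in: "p n \<in> S" for n unfolding p_def by (intro subspace_sum[OF S] u_in)
  have Tp: "p n - T \<epsilon> (p n) = g - u n" for n
  proof (induction n)
    case 0
    have "T \<epsilon> 0 = 0" using T_scale[OF g, of \<epsilon> 0] by simp
    thus ?case by (simp add: p_def u_def)
  next
    case (Suc n)
    have "p (Suc n) = p n + u n" by (simp add: p_def)
    hence "p (Suc n) - T \<epsilon> (p (Suc n)) = (p n - T \<epsilon> (p n)) + (u n - u (Suc n))"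
      by (simp add: T_add p_in u_in u_Suc)
    thus ?case using Suc by simp
  qed
  define d where "d = s - T \<epsilon> s - g"
  have d_in: "d \<in> S" unfolding d_def by (intro S_rules T_in s g)
  have "N d \<le> N (s - p n) + rate * N (s - p n) + rate ^ n * N g" for n
  proof -
    have "d = (s - p n) - T \<epsilon> (s - p n) - u n"
      using Tp[of n] s p_in by (simp add: d_def T_diff algebra_simps)
    hence "N d \<le> N ((s - p n) - T \<epsilon> (s - p n)) + N (u n)"
      using N_minus[of "(s - p n) - T \<epsilon> (s - p n)" "u n"] by (simp add: S_rules T_in s p_in u_in)
    also have "N ((s - p n) - T \<epsilon> (s - p n)) \<le> N (s - p n) + N (T \<epsilon> (s - p n))"
      by (intro N_minus S_rules T_in s p_in)
    also have "N (T \<epsilon> (s - p n)) \<le> rate * N (s - p n)"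
      by (intro T_contr[OF _ \<epsilon>] S_rules s p_in)
    finally show ?thesis using u_le[of n] by linarith
  qed
  moreover have "(\<lambda>n. N (s - p n) + rate * N (s - p n) + rate ^ n * N g) \<longlonglongrightarrow> 0 + rate * 0 + 0"
    using s(2) unfolding p_def by (intro tendsto_intros lim)
  ultimately have "N d \<le> 0" by (intro LIMSEQ_le_const[of _ 0]) auto
  hence "d = 0" using N_eq_0[OF d_in] N_nonneg[OF d_in] by linarith
  hence "g = s - T \<epsilon> s" by (simp add: d_def)
  thus "g \<in> (\<lambda>f. f - T \<epsilon> f) ` S" using s by blast
qed

context
  fixes \<epsilon> assumes \<epsilon>: "\<epsilon> \<in> {0..threshold}"
begin

lemma Q_in: "g \<in> S \<Longrightarrow> Q \<epsilon> g \<in> S"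
  unfolding Q_def using bij_betw_the_inv_into[OF bij_I_minus_T[OF \<epsilon>]] by (auto simp: bij_betw_def)

lemma Q_eq: "g \<in> S \<Longrightarrow> Q \<epsilon> g - T \<epsilon> (Q \<epsilon> g) = g"
  unfolding Q_def using bij_I_minus_T[OF \<epsilon>] f_the_inv_into_f[of "\<lambda>f. f - T \<epsilon> f" S g]
  by (auto simp: bij_betw_def)

lemma Q_unique: "f \<in> S \<Longrightarrow> f - T \<epsilon> f = g \<Longrightarrow> Q \<epsilon> g = f"
  unfolding Q_def using bij_I_minus_T[OF \<epsilon>] the_inv_into_f_f[of "\<lambda>f. f - T \<epsilon> f" S f]
  by (auto simp: bij_betw_def)

lemma Q_add: "f \<in> S \<Longrightarrow> g \<in> S \<Longrightarrow> Q \<epsilon> (f + g) = Q \<epsilon> f + Q \<epsilon> g"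
  using arg_cong2[OF Q_eq[of f] Q_eq[of g], of "(+)"]
  by (intro Q_unique S_rules Q_in) (simp_all add: T_add Q_in add_diff_add)

lemma Q_scale: "g \<in> S \<Longrightarrow> Q \<epsilon> (c *\<^sub>R g) = c *\<^sub>R Q \<epsilon> g"
  using Q_eq[of g]
  by (intro Q_unique S_rules Q_in) (simp_all add: T_scale Q_in flip: scaleR_diff_right)

lemma Q_bound:
  assumes "g \<in> S"
  shows "N (Q \<epsilon> g) \<le> N g / (1 - rate)"
proof -
  have "N (Q \<epsilon> g) \<le> N g + N (T \<epsilon> (Q \<epsilon> g))"
    using N_add[of g "T \<epsilon> (Q \<epsilon> g)"] Q_eq[OF assms] assms Q_in T_in by (metis diff_add_cancel)
  also have "\<dots> \<le> N g + rate * N (Q \<epsilon> g)" using T_contr[OF Q_in[OF assms] \<epsilon>] by simp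
  finally show ?thesis using rate by (simp add: field_simps)
qed

lemma QP_bound:
  assumes "g \<in> S"
  shows "N (Q \<epsilon> (P g)) \<le> (K + q) / (1 - rate) * N g"
proof -
  have "N (Q \<epsilon> (P g)) \<le> N (P g) / (1 - rate)" by (intro Q_bound P_in assms)
  also have "\<dots> \<le> (K + q) * N g / (1 - rate)" using rate by (intro divide_right_mono P_bound assms) auto
  finally show ?thesis by simp
qed

end

text \<open>The resolvent identity, in the form that is iterated below.\<close>

lemma Q_resolvent:
  assumes s: "s \<in> {0..threshold}" and t: "t \<in> {0..threshold}" and g: "g \<in> S"
  shows "Q t g = Q s g + (t - s) *\<^sub>R Q t (P (Q s g))"
proof (rule Q_unique[OF t])
  let ?f = "Q s g"
  have f: "?f \<in> S" by (rule Q_in[OF s g])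
  show "?f + (t - s) *\<^sub>R Q t (P ?f) \<in> S" by (intro S_rules Q_in[OF t] P_in f)
  have "T t (?f + (t - s) *\<^sub>R Q t (P ?f)) = T t ?f + (t - s) *\<^sub>R T t (Q t (P ?f))"
    by (simp add: T_add T_scale S_rules Q_in[OF t] P_in f del: scaleR_diff_left)
  also have "T t ?f = T s ?f + (t - s) *\<^sub>R P ?f" by (simp add: T_def P_def algebra_simps)
  finally have "?f + (t - s) *\<^sub>R Q t (P ?f) - T t (?f + (t - s) *\<^sub>R Q t (P ?f))
      = (?f - T s ?f) + (t - s) *\<^sub>R ((Q t (P ?f) - T t (Q t (P ?f))) - P ?f)"
    by (simp add: algebra_simps)
  also have "Q t (P ?f) - T t (Q t (P ?f)) = P ?f" by (intro Q_eq[OF t] P_in f)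
  finally show "?f + (t - s) *\<^sub>R Q t (P ?f) - T t (?f + (t - s) *\<^sub>R Q t (P ?f)) = g"
    using Q_eq[OF s g] by simp
qed

text \<open>Iterating the resolvent identity shows that these are the Taylor coefficients of
  \<open>t \<mapsto> Q t v\<close> at \<open>t = \<epsilon>\<close>.\<close>

primrec W :: "'a \<Rightarrow> nat \<Rightarrow> real \<Rightarrow> 'a" where
  "W v 0 \<epsilon> = Q \<epsilon> v"
| "W v (Suc n) \<epsilon> = Q \<epsilon> (P (W v n \<epsilon>))"

lemma W_in: "v \<in> S \<Longrightarrow> \<epsilon> \<in> {0..threshold} \<Longrightarrow> W v n \<epsilon> \<in> S"
  by (induction n) (auto intro: Q_in P_in)

lemma W_Taylor:
  assumes v: "v \<in> S" and s: "s \<in> {0..threshold}" and t: "t \<in> {0..threshold}"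
  shows "Q t v = (\<Sum>n\<le>k. (t - s) ^ n *\<^sub>R W v n s) + (t - s) ^ Suc k *\<^sub>R Q t (P (W v k s))"
proof (induction k)
  case 0
  show ?case using Q_resolvent[OF s t v] by simp
next
  case (Suc k)
  have "Q t (P (W v k s)) = W v (Suc k) s + (t - s) *\<^sub>R Q t (P (W v (Suc k) s))"
    using Q_resolvent[OF s t P_in[OF W_in[OF v s]], of k] by simp
  hence "(t - s) ^ Suc k *\<^sub>R Q t (P (W v k s)) = (t - s) ^ Suc k *\<^sub>R W v (Suc k) s
      + (t - s) ^ Suc (Suc k) *\<^sub>R Q t (P (W v (Suc k) s))"
    by (simp add: scaleR_add_right mult.commute)
  thus ?case unfolding Suc by simp
qed

text \<open>Replacing one resolvent after the other in \<open>(Q \<epsilon> P)\<^sup>n Q \<epsilon> v\<close> contributes one copy of the next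
  coefficient for each of the \<open>n + 1\<close> resolvents, whence the factor \<open>n + 1\<close>.  The error estimate is
  uniform in \<open>t\<close> since the resolvents are uniformly bounded.\<close>

lemma W_derivative:
  assumes v: "v \<in> S" and s: "s \<in> {0..threshold}"
  shows "\<exists>C. \<forall>t\<in>{0..threshold}.
    N (W v n t - W v n s - (t - s) *\<^sub>R real (Suc n) *\<^sub>R W v (Suc n) s) \<le> C * (t - s)\<^sup>2"
proof -
  define c where "c = (K + q) / (1 - rate)"
  have c: "0 \<le> c" using K q rate by (auto simp: c_def)
  have QP: "N (Q t (P g)) \<le> c * N g" if "t \<in> {0..threshold}" "g \<in> S" for t g
    unfolding c_def by (rule QP_bound[OF that])
  show ?thesis
  proof (induction n)
    case 0
    show ?case
    proof (intro exI ballI)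
      fix t assume t: "t \<in> {0..threshold}"
      have "W v 0 t - W v 0 s - (t - s) *\<^sub>R real (Suc 0) *\<^sub>R W v (Suc 0) s
          = (t - s)\<^sup>2 *\<^sub>R Q t (P (W v 1 s))"
        using W_Taylor[OF v s t, of 1] by (simp add: power2_eq_square algebra_simps)
      also have "N \<dots> = (t - s)\<^sup>2 * N (Q t (P (W v 1 s)))"
        by (subst N_scale) (auto intro!: Q_in[OF t] P_in Q_in[OF s] v)
      also have "\<dots> \<le> (t - s)\<^sup>2 * (c * N (W v 1 s))"
        by (intro mult_left_mono QP[OF t] W_in v s) auto
      finally show "N (W v 0 t - W v 0 s - (t - s) *\<^sub>R real (Suc 0) *\<^sub>R W v (Suc 0) s)
          \<le> (c * N (W v 1 s)) * (t - s)\<^sup>2"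
        by (simp add: mult_ac)
    qed
  next
    case (Suc n)
    then obtain C where C: "\<And>t. t \<in> {0..threshold} \<Longrightarrow>
      N (W v n t - W v n s - (t - s) *\<^sub>R real (Suc n) *\<^sub>R W v (Suc n) s) \<le> C * (t - s)\<^sup>2" by blast
    show ?case
    proof (intro exI ballI)
      fix t assume t: "t \<in> {0..threshold}"
      define X where "X = W v n t - W v n s - (t - s) *\<^sub>R real (Suc n) *\<^sub>R W v (Suc n) s"
      define Y where "Y = W v (Suc (Suc n)) s"
      note W = W_in[OF v s] W_in[OF v t]
      have X: "X \<in> S" unfolding X_def by (intro S_rules W)
      have Y: "Y \<in> S" unfolding Y_def by (intro W)
      have W1: "W v (Suc n) s = Q s (P (W v n s))" by simp
      \<comment> \<open>The error of \<open>W v (Suc n)\<close> is the propagated error \<open>X\<close> of \<open>W v n\<close> plus second-order terms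
        from replacing \<open>Q t\<close> by \<open>Q s\<close>.\<close>
      have 1: "Q t (P X) = W v (Suc n) t - Q t (P (W v n s))
                 - ((t - s) * real (Suc n)) *\<^sub>R Q t (P (W v (Suc n) s))"
      proof -
        have "W v n t = X + W v n s + ((t - s) * real (Suc n)) *\<^sub>R W v (Suc n) s"
          by (simp add: X_def)
        hence "W v (Suc n) t = Q t (P (X + W v n s + ((t - s) * real (Suc n)) *\<^sub>R W v (Suc n) s))"
          by (simp only: W.simps)
        also have "\<dots> = Q t (P X) + Q t (P (W v n s))
                 + ((t - s) * real (Suc n)) *\<^sub>R Q t (P (W v (Suc n) s))"
          by (simp only: P_add P_scale Q_add[OF t] Q_scale[OF t] S_rules P_in X W)
        finally show ?thesis by simp
      qed
      have 2: "Q t (P (W v n s)) = W v (Suc n) s + (t - s) *\<^sub>R Q t (P (W v (Suc n) s))"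
        using Q_resolvent[OF s t P_in[OF W(1)]] by simp
      have 3: "Q t (P (W v (Suc n) s)) = Y + (t - s) *\<^sub>R Q t (P Y)"
        using Q_resolvent[OF s t P_in[OF W(1)[of "Suc n"]]] unfolding Y_def W.simps(2)[of v "Suc n"] .
      have "N (W v (Suc n) t - W v (Suc n) s - (t - s) *\<^sub>R real (Suc (Suc n)) *\<^sub>R Y)
          = N (Q t (P X) + ((t - s)\<^sup>2 * real (Suc (Suc n))) *\<^sub>R Q t (P Y))"
      proof -
        define \<tau> m where "\<tau> = t - s" and "m = real (Suc n)"
        have m: "real (Suc (Suc n)) = m + 1" by (simp add: m_def)
        show ?thesis
          unfolding 1 2 3 m unfolding \<tau>_def[symmetric] m_def[symmetric]
          by (simp add: power2_eq_square algebra_simps)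
      qed
      also have "\<dots> \<le> N (Q t (P X)) + N (((t - s)\<^sup>2 * real (Suc (Suc n))) *\<^sub>R Q t (P Y))"
        by (intro N_add S_rules Q_in[OF t] P_in X Y)
      also have "\<dots> = N (Q t (P X)) + (t - s)\<^sup>2 * real (Suc (Suc n)) * N (Q t (P Y))"
        by (subst N_scale) (auto intro!: Q_in[OF t] P_in Y simp: abs_mult)
      also have "\<dots> \<le> c * (C * (t - s)\<^sup>2) + (t - s)\<^sup>2 * real (Suc (Suc n)) * (c * N Y)"
        using QP[OF t X] C[OF t, folded X_def] c
        by (intro add_mono mult_left_mono QP[OF t] Y order_trans[OF QP[OF t X]]) auto
      finally show "N (W v (Suc n) t - W v (Suc n) s
            - (t - s) *\<^sub>R real (Suc (Suc n)) *\<^sub>R W v (Suc (Suc n)) s)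
          \<le> (c * C + real (Suc (Suc n)) * (c * N Y)) * (t - s)\<^sup>2"
        unfolding Y_def by (simp add: algebra_simps)
    qed
  qed
qed

end

section \<open>Functions as vectors\<close>

instantiation "fun" :: (type, real_vector) real_vector
begin

definition scaleR_fun :: "real \<Rightarrow> ('a \<Rightarrow> 'b) \<Rightarrow> 'a \<Rightarrow> 'b" where
  "scaleR_fun c f = (\<lambda>x. c *\<^sub>R f x)"

instance
  by standard (auto simp: scaleR_fun_def fun_eq_iff algebra_simps)

end

lemma scaleR_fun_apply [simp]: "(c *\<^sub>R f) x = c *\<^sub>R f x"
  by (simp add: scaleR_fun_def)

section \<open>The space \<open>C\<^sup>l([0,1])\<close>\<close>

lemma deriv_cong01:
  assumes "(f has_real_derivative d) (at x within {0..1})" "x \<in> {0..1}"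
    and "\<And>y. y \<in> {0..1} \<Longrightarrow> g y = f y"
  shows "(g has_real_derivative d) (at x within {0..1})"
  using assms has_vector_derivative_transform[of x "{0..1}" g f d]
  by (simp add: has_real_derivative_iff_has_vector_derivative)

lemma series_deriv:
  fixes u u' :: "nat \<Rightarrow> real \<Rightarrow> real"
  assumes "\<And>n x. x \<in> {0..1} \<Longrightarrow> (u n has_real_derivative u' n x) (at x within {0..1})"
    and "\<And>n x. x \<in> {0..1} \<Longrightarrow> \<bar>u' n x\<bar> \<le> m n" and "summable m"
    and "summable (\<lambda>n. u n 0)" and x: "x \<in> {0..1}"
  shows "((\<lambda>x. \<Sum>n. u n x) has_real_derivative (\<Sum>n. u' n x)) (at x within {0..1})"
proof -
  have "uniform_limit {0..1} (\<lambda>n x. \<Sum>i<n. u' i x) (\<lambda>x. \<Sum>i. u' i x) sequentially"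
    by (rule Weierstrass_m_test[where M = m]) (use assms in auto)
  hence "\<exists>g. \<forall>x\<in>{0..1}. (\<lambda>n. u n x) sums g x \<and>
      (g has_real_derivative (\<Sum>n. u' n x)) (at x within {0..1})"
    by (intro has_field_derivative_series[where f = u and f' = u' and ?x0.0 = 0] assms) auto
  then obtain g where g: "\<And>x. x \<in> {0..1} \<Longrightarrow> (\<lambda>n. u n x) sums g x"
      "\<And>x. x \<in> {0..1} \<Longrightarrow> (g has_real_derivative (\<Sum>n. u' n x)) (at x within {0..1})"
    by blast
  have "(\<Sum>n. u n y) = g y" if "y \<in> {0..1}" for y using g(1)[OF that] by (simp add: sums_iff)
  thus ?thesis by (rule deriv_cong01[OF g(2)[OF x] x])
qed

definition sup01 :: "(real \<Rightarrow> real) \<Rightarrow> real" where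
  "sup01 g = (SUP x\<in>{0..1}. \<bar>g x\<bar>)"

lemma sup01_cong: "(\<And>x. x \<in> {0..1} \<Longrightarrow> f x = g x) \<Longrightarrow> sup01 f = sup01 g"
  unfolding sup01_def by (intro SUP_cong) auto

lemma sup01_le: "(\<And>x. x \<in> {0..1} \<Longrightarrow> \<bar>g x\<bar> \<le> c) \<Longrightarrow> sup01 g \<le> c"
  unfolding sup01_def by (intro cSUP_least) auto

lemma le_sup01:
  assumes "continuous_on {0..1} g" "x \<in> {0..1}"
  shows "\<bar>g x\<bar> \<le> sup01 g"
proof -
  have "compact ((\<lambda>x. \<bar>g x\<bar>) ` {0..1})"
    by (intro compact_continuous_image continuous_intros assms) auto
  hence "bdd_above ((\<lambda>x. \<bar>g x\<bar>) ` {0..1})"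
    by (intro bounded_imp_bdd_above compact_imp_bounded)
  thus ?thesis unfolding sup01_def using assms by (intro cSUP_upper) auto
qed

lemma sup01_nonneg: "continuous_on {0..1} g \<Longrightarrow> 0 \<le> sup01 g"
  using le_sup01[of g 0] by (auto intro: order_trans[OF abs_ge_zero])

lemma sup01_add:
  assumes "continuous_on {0..1} f" "continuous_on {0..1} g"
  shows "sup01 (\<lambda>x. f x + g x) \<le> sup01 f + sup01 g"
  by (intro sup01_le order_trans[OF abs_triangle_ineq] add_mono le_sup01 assms)

lemma sup01_scale:
  assumes "continuous_on {0..1} f"
  shows "sup01 (\<lambda>x. c * f x) = \<bar>c\<bar> * sup01 f"
proof (rule antisym)
  show "sup01 (\<lambda>x. c * f x) \<le> \<bar>c\<bar> * sup01 f"
    by (intro sup01_le) (auto simp: abs_mult intro!: mult_left_mono le_sup01 assms)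
  show "\<bar>c\<bar> * sup01 f \<le> sup01 (\<lambda>x. c * f x)"
  proof (cases "c = 0")
    case True
    thus ?thesis by (simp add: sup01_def)
  next
    case False
    have "sup01 f \<le> sup01 (\<lambda>x. c * f x) / \<bar>c\<bar>"
    proof (rule sup01_le)
      fix x :: real assume "x \<in> {0..1}"
      hence "\<bar>c * f x\<bar> \<le> sup01 (\<lambda>x. c * f x)"
        by (intro le_sup01[of "\<lambda>x. c * f x"] continuous_intros assms)
      thus "\<bar>f x\<bar> \<le> sup01 (\<lambda>x. c * f x) / \<bar>c\<bar>" using False by (simp add: abs_mult field_simps)
    qed
    thus ?thesis using False by (simp add: field_simps)
  qed
qed

text \<open>The derivatives of a function are handled as a sequence \<open>F\<close> of candidates, because
  \<open>D01\<close> is determined on \<open>[0,1]\<close> only.\<close>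

definition jet :: "nat \<Rightarrow> (nat \<Rightarrow> real \<Rightarrow> real) \<Rightarrow> bool" where
  "jet l F \<longleftrightarrow> (\<forall>j<l. \<forall>x\<in>{0..1}. (F j has_real_derivative F (Suc j) x) (at x within {0..1})) \<and>
     continuous_on {0..1} (F l)"

lemma jetI:
  "(\<And>j x. j < l \<Longrightarrow> x \<in> {0..1} \<Longrightarrow> (F j has_real_derivative F (Suc j) x) (at x within {0..1})) \<Longrightarrow>
   continuous_on {0..1} (F l) \<Longrightarrow> jet l F"
  by (auto simp: jet_def)

lemma jetD:
  "jet l F \<Longrightarrow> j < l \<Longrightarrow> x \<in> {0..1} \<Longrightarrow> (F j has_real_derivative F (Suc j) x) (at x within {0..1})"
  by (auto simp: jet_def)

lemma jet_continuous: "jet l F \<Longrightarrow> j \<le> l \<Longrightarrow> continuous_on {0..1} (F j)"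
  by (cases "j < l")
     (auto simp: jet_def continuous_on_eq_continuous_within intro!: DERIV_continuous)

lemma D01_eq:
  assumes "(f has_real_derivative d) (at x within {0..1})" "x \<in> {0..1}"
  shows "D01 f x = d"
  using assms unfolding D01_def has_real_derivative_iff_has_vector_derivative
  by (intro vector_derivative_within_cbox[of 0 1, unfolded cbox_interval]) auto

lemma jet_D01:
  assumes "jet l F" "\<And>x. x \<in> {0..1} \<Longrightarrow> f x = F 0 x" "j \<le> l" "x \<in> {0..1}"
  shows "(D01 ^^ j) f x = F j x"
  using assms(3,4)
proof (induction j arbitrary: x)
  case (Suc j)
  have "(F j has_real_derivative F (Suc j) x) (at x within {0..1})"
    using jetD[OF assms(1), of j x] Suc.prems by auto
  hence "((D01 ^^ j) f has_real_derivative F (Suc j) x) (at x within {0..1})"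
    by (rule deriv_cong01) (use Suc in auto)
  thus ?case using Suc.prems by (simp add: D01_eq)
qed (use assms in auto)

lemma C_space_jet:
  assumes "f \<in> C_space l"
  shows "jet l (\<lambda>j. (D01 ^^ j) f)"
proof (rule jetI)
  fix j x assume "j < l" "x \<in> {0..1::real}"
  hence "(D01 ^^ j) f differentiable (at x within {0..1})"
    using assms by (auto simp: C_space_def differentiable_on_def)
  thus "((D01 ^^ j) f has_real_derivative (D01 ^^ Suc j) f x) (at x within {0..1})"
    by (simp add: D01_def has_real_derivative_iff_has_vector_derivative flip: vector_derivative_works)
qed (use assms in \<open>auto simp: C_space_def\<close>)

lemma C_spaceI:
  assumes "\<And>x. x \<notin> {0..1} \<Longrightarrow> f x = 0" "jet l F" "\<And>x. x \<in> {0..1} \<Longrightarrow> f x = F 0 x"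
  shows "f \<in> C_space l"
proof -
  note eq = jet_D01[OF assms(2,3)]
  have "(D01 ^^ j) f differentiable_on {0..1}" if "j < l" for j
    unfolding differentiable_on_def
  proof
    fix x :: real assume x: "x \<in> {0..1}"
    have "((D01 ^^ j) f has_real_derivative F (Suc j) x) (at x within {0..1})"
      by (rule deriv_cong01[OF jetD[OF assms(2) that x] x]) (use eq that in auto)
    thus "(D01 ^^ j) f differentiable (at x within {0..1})"
      by (auto simp: has_field_derivative_def differentiable_def)
  qed
  moreover have "continuous_on {0..1} ((D01 ^^ l) f)"
    using jet_continuous[OF assms(2), of l] by (subst continuous_on_cong[OF refl eq]) auto
  ultimately show ?thesis using assms(1) by (auto simp: C_space_def)
qed

lemma C_space_outside: "f \<in> C_space l \<Longrightarrow> x \<notin> {0..1} \<Longrightarrow> f x = 0"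
  by (auto simp: C_space_def)

lemma C_space_continuous: "f \<in> C_space l \<Longrightarrow> j \<le> l \<Longrightarrow> continuous_on {0..1} ((D01 ^^ j) f)"
  using jet_continuous[OF C_space_jet] .

lemma C_space_continuous0: "f \<in> C_space l \<Longrightarrow> continuous_on {0..1} f"
  using C_space_continuous[of f l 0] by simp

lemma C_space_mono:
  assumes "f \<in> C_space l" "k \<le> l"
  shows "f \<in> C_space k"
  using assms jet_continuous[OF C_space_jet[OF assms(1)] assms(2)] by (auto simp: C_space_def)

lemma jet_add: "jet l F \<Longrightarrow> jet l G \<Longrightarrow> jet l (\<lambda>j x. F j x + G j x)"
  by (auto simp: jet_def intro!: derivative_intros continuous_intros)

lemma jet_scale: "jet l F \<Longrightarrow> jet l (\<lambda>j x. c * F j x)"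
  by (auto simp: jet_def intro!: DERIV_cmult continuous_intros)

lemma C_norm_sup01: "C_norm l f = (\<Sum>j\<le>l. sup01 ((D01 ^^ j) f))"
  by (simp add: C_norm_def sup01_def)

context
  fixes l :: nat and f g :: "real \<Rightarrow> real"
  assumes f: "f \<in> C_space l" and g: "g \<in> C_space l"
begin

lemma C_space_add: "f + g \<in> C_space l"
  by (rule C_spaceI[OF _ jet_add[OF C_space_jet[OF f] C_space_jet[OF g]]])
     (auto simp: C_space_outside[OF f] C_space_outside[OF g])

lemma D01_add: "j \<le> l \<Longrightarrow> x \<in> {0..1} \<Longrightarrow> (D01 ^^ j) (f + g) x = (D01 ^^ j) f x + (D01 ^^ j) g x"
  by (rule jet_D01[OF jet_add[OF C_space_jet[OF f] C_space_jet[OF g]]]) auto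

lemma C_norm_add: "C_norm l (f + g) \<le> C_norm l f + C_norm l g"
  unfolding C_norm_sup01 sum.distrib[symmetric]
proof (rule sum_mono)
  fix j assume j: "j \<in> {..l}"
  have "sup01 ((D01 ^^ j) (f + g)) = sup01 (\<lambda>x. (D01 ^^ j) f x + (D01 ^^ j) g x)"
    using D01_add j by (intro sup01_cong) auto
  also have "\<dots> \<le> sup01 ((D01 ^^ j) f) + sup01 ((D01 ^^ j) g)"
    using j by (intro sup01_add C_space_continuous[OF f] C_space_continuous[OF g]) auto
  finally show "sup01 ((D01 ^^ j) (f + g)) \<le> sup01 ((D01 ^^ j) f) + sup01 ((D01 ^^ j) g)" .
qed

end

context
  fixes l :: nat and f :: "real \<Rightarrow> real"
  assumes f: "f \<in> C_space l"
begin

lemma C_space_scale: "c *\<^sub>R f \<in> C_space l"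
  by (rule C_spaceI[OF _ jet_scale[OF C_space_jet[OF f]]]) (auto simp: C_space_outside[OF f])

lemma D01_scale: "j \<le> l \<Longrightarrow> x \<in> {0..1} \<Longrightarrow> (D01 ^^ j) (c *\<^sub>R f) x = c * (D01 ^^ j) f x"
  by (rule jet_D01[OF jet_scale[OF C_space_jet[OF f]]]) auto

lemma C_norm_scale: "C_norm l (c *\<^sub>R f) = \<bar>c\<bar> * C_norm l f"
  unfolding C_norm_sup01 sum_distrib_left
proof (rule sum.cong[OF refl])
  fix j assume j: "j \<in> {..l}"
  have "sup01 ((D01 ^^ j) (c *\<^sub>R f)) = sup01 (\<lambda>x. c * (D01 ^^ j) f x)"
    using D01_scale j by (intro sup01_cong) auto
  also have "\<dots> = \<bar>c\<bar> * sup01 ((D01 ^^ j) f)"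
    using j by (intro sup01_scale C_space_continuous[OF f]) auto
  finally show "sup01 ((D01 ^^ j) (c *\<^sub>R f)) = \<bar>c\<bar> * sup01 ((D01 ^^ j) f)" .
qed

lemma sup01_le_C_norm: "j \<le> l \<Longrightarrow> sup01 ((D01 ^^ j) f) \<le> C_norm l f"
  unfolding C_norm_sup01 using f
  by (intro member_le_sum) (auto intro!: sup01_nonneg C_space_continuous)

lemma le_C_norm: "j \<le> l \<Longrightarrow> x \<in> {0..1} \<Longrightarrow> \<bar>(D01 ^^ j) f x\<bar> \<le> C_norm l f"
  using sup01_le_C_norm le_sup01[OF C_space_continuous[OF f]] by (meson order_trans)

lemma C_norm_nonneg: "0 \<le> C_norm l f"
  unfolding C_norm_sup01 using f by (auto intro!: sum_nonneg sup01_nonneg C_space_continuous)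

lemma C_norm_eq_0: "C_norm l f = 0 \<Longrightarrow> f = 0"
  using le_C_norm[of 0] C_space_outside[OF f] by (force simp: fun_eq_iff)

lemma integral_le_C_norm: "\<bar>integral {0..1} f\<bar> \<le> C_norm l f"
  using integral_bound[of 0 1 f "C_norm l f"] C_space_continuous0[OF f] le_C_norm[of 0] by simp

end

lemma subspace_C_space: "subspace (C_space l)"
proof (rule subspaceI)
  show "0 \<in> C_space l" by (rule C_spaceI[where F = "\<lambda>_ _. 0"]) (auto simp: jet_def)
qed (auto intro: C_space_add C_space_scale)

lemma subspace_C_space0: "subspace (C_space0 l)"
proof (rule subspaceI)
  show "0 \<in> C_space0 l" using subspace_0[OF subspace_C_space] by (auto simp: C_space0_def zero_fun_def)
next
  fix f g assume fg: "f \<in> C_space0 l" "g \<in> C_space0 l"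
  have "integral {0..1} (\<lambda>x. f x + g x) = integral {0..1} f + integral {0..1} g"
    using fg by (intro integral_add integrable_continuous_real C_space_continuous0[of _ l])
      (auto simp: C_space0_def)
  thus "f + g \<in> C_space0 l" using fg C_space_add[of f l g] by (simp add: C_space0_def plus_fun_def)
next
  fix c f assume f: "f \<in> C_space0 l"
  thus "c *\<^sub>R f \<in> C_space0 l" using C_space_scale[of f l c] by (simp add: C_space0_def scaleR_fun_def)
qed

lemmas C_space_diff = subspace_diff[OF subspace_C_space]

lemma D01_diff:
  assumes "f \<in> C_space l" "g \<in> C_space l" "j \<le> l" "x \<in> {0..1}"
  shows "(D01 ^^ j) (f - g) x = (D01 ^^ j) f x - (D01 ^^ j) g x"
  using D01_add[OF assms(1) C_space_scale[OF assms(2)], of j x "-1"] D01_scale[OF assms(2-4), of "-1"]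
    assms by simp

lemma D01_sum:
  fixes u :: "nat \<Rightarrow> real \<Rightarrow> real"
  assumes "\<And>i. u i \<in> C_space l" "j \<le> l" "x \<in> {0..1}"
  shows "(D01 ^^ j) (\<Sum>i<n. u i) x = (\<Sum>i<n. (D01 ^^ j) (u i) x)"
proof (induction n)
  case 0
  have "(D01 ^^ j) (0 *\<^sub>R u 0) x = 0 * (D01 ^^ j) (u 0) x" by (rule D01_scale) (use assms in auto)
  thus ?case by (simp add: zero_fun_def)
next
  case (Suc n)
  have "(\<Sum>i<n. u i) \<in> C_space l" by (intro subspace_sum[OF subspace_C_space] assms)
  hence "(D01 ^^ j) ((\<Sum>i<n. u i) + u n) x = (\<Sum>i<Suc n. (D01 ^^ j) (u i) x)"
    using Suc D01_add[OF _ assms(1) assms(2,3)] by simp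
  thus ?case by (simp only: sum.lessThan_Suc)
qed

text \<open>Completeness: an absolutely convergent series in \<open>C\<^sup>l\<close> may be differentiated termwise.\<close>

lemma C_space_complete:
  assumes u: "\<And>n. u n \<in> C_space l" and sm: "summable (\<lambda>n. C_norm l (u n))"
  shows "\<exists>s\<in>C_space l. (\<lambda>n. C_norm l (s - (\<Sum>i<n. u i))) \<longlonglongrightarrow> 0"
proof -
  define F where "F j x = (\<Sum>n. (D01 ^^ j) (u n) x)" for j x
  define s where "s x = (if x \<in> {0..1} then F 0 x else 0)" for x
  have bound: "\<bar>(D01 ^^ j) (u n) x\<bar> \<le> C_norm l (u n)" if "j \<le> l" "x \<in> {0..1}" for j n x
    by (rule le_C_norm[OF u that])
  have sm': "summable (\<lambda>n. (D01 ^^ j) (u n) x)" if "j \<le> l" "x \<in> {0..1}" for j x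
    by (rule summable_comparison_test'[OF sm]) (use bound[OF that] in auto)
  have jet: "jet l F"
  proof (rule jetI)
    fix j x assume j: "j < l" and x: "x \<in> {0..1::real}"
    show "(F j has_real_derivative F (Suc j) x) (at x within {0..1})"
      unfolding F_def using j
      by (intro series_deriv[OF _ bound sm sm' x] jetD[OF C_space_jet[OF u]]) auto
  next
    have "uniform_limit {0..1} (\<lambda>n x. \<Sum>i<n. (D01 ^^ l) (u i) x) (F l) sequentially"
      unfolding F_def by (rule Weierstrass_m_test[OF _ sm]) (use bound in auto)
    thus "continuous_on {0..1} (F l)"
      by (rule uniform_limit_theorem[rotated])
         (auto intro!: always_eventually continuous_intros C_space_continuous[OF u])
  qed
  have s: "s \<in> C_space l" by (rule C_spaceI[OF _ jet]) (auto simp: s_def)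
  define tail where "tail n = (\<Sum>i. C_norm l (u i)) - (\<Sum>i<n. C_norm l (u i))" for n
  have "C_norm l (s - (\<Sum>i<n. u i)) \<le> (\<Sum>j\<le>l. tail n)" for n
    unfolding C_norm_sup01
  proof (intro sum_mono sup01_le)
    fix j x assume j: "j \<in> {..l}" and x: "x \<in> {0..1::real}"
    hence j: "j \<le> l" by simp
    have shift: "summable (\<lambda>i. C_norm l (u (i + n)))" using sm by (subst summable_iff_shift)
    have abs_sm: "summable (\<lambda>i. \<bar>(D01 ^^ j) (u (i + n)) x\<bar>)"
      by (rule summable_comparison_test'[OF shift]) (use bound[OF j x] in auto)
    have "(D01 ^^ j) (s - (\<Sum>i<n. u i)) x = F j x - (\<Sum>i<n. (D01 ^^ j) (u i) x)"
      using D01_diff[OF s subspace_sum[OF subspace_C_space] j x, of "{..<n}" u] u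
        D01_sum[of u, OF u j x, of n] jet_D01[OF jet _ j x, of s] by (simp add: s_def)
    also have "\<dots> = (\<Sum>i. (D01 ^^ j) (u (i + n)) x)"
      unfolding F_def by (rule suminf_minus_initial_segment[OF sm'[OF j x], symmetric])
    also have "\<bar>\<dots>\<bar> \<le> (\<Sum>i. \<bar>(D01 ^^ j) (u (i + n)) x\<bar>)"
      by (rule summable_rabs[OF abs_sm])
    also have "\<dots> \<le> (\<Sum>i. C_norm l (u (i + n)))"
      by (intro suminf_le bound[OF j x] abs_sm shift)
    also have "\<dots> = tail n" unfolding tail_def by (rule suminf_minus_initial_segment[OF sm])
    finally show "\<bar>(D01 ^^ j) (s - (\<Sum>i<n. u i)) x\<bar> \<le> tail n" .
  qed
  moreover have "0 \<le> C_norm l (s - (\<Sum>i<n. u i))" for n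
    by (intro C_norm_nonneg C_space_diff subspace_sum[OF subspace_C_space] s u)
  moreover have "(\<lambda>n. \<Sum>j\<le>l. tail n) \<longlonglongrightarrow> (\<Sum>j\<le>l. (\<Sum>i. C_norm l (u i)) - (\<Sum>i. C_norm l (u i)))"
    unfolding tail_def by (intro tendsto_intros summable_LIMSEQ sm)
  ultimately have "(\<lambda>n. C_norm l (s - (\<Sum>i<n. u i))) \<longlonglongrightarrow> 0"
    using tendsto_sandwich[of "\<lambda>_. 0" "\<lambda>n. C_norm l (s - (\<Sum>i<n. u i))" sequentially
        "\<lambda>n. \<Sum>j\<le>l. tail n" 0] by simp
  with s show ?thesis by blast
qed

lemma C_space0_complete:
  assumes u: "\<And>n. u n \<in> C_space0 l" and sm: "summable (\<lambda>n. C_norm l (u n))"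
  shows "\<exists>s\<in>C_space0 l. (\<lambda>n. C_norm l (s - (\<Sum>i<n. u i))) \<longlonglongrightarrow> 0"
proof -
  have u': "u n \<in> C_space l" for n using u by (simp add: C_space0_def)
  obtain s where s: "s \<in> C_space l" "(\<lambda>n. C_norm l (s - (\<Sum>i<n. u i))) \<longlonglongrightarrow> 0"
    using C_space_complete[OF u' sm] by blast
  have p: "(\<Sum>i<n. u i) \<in> C_space0 l" for n by (intro subspace_sum[OF subspace_C_space0] u)
  have "\<bar>integral {0..1} s\<bar> \<le> C_norm l (s - (\<Sum>i<n. u i))" for n
  proof -
    let ?p = "\<Sum>i<n. u i"
    have p': "?p \<in> C_space l" "integral {0..1} ?p = 0" using p by (auto simp: C_space0_def)
    have "integral {0..1} (\<lambda>x. s x - ?p x) = integral {0..1} s - integral {0..1} ?p"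
      by (intro integral_diff integrable_continuous_real C_space_continuous0[of _ l] s p')
    hence "integral {0..1} s = integral {0..1} (s - ?p)" using p' by (simp add: fun_diff_def)
    also have "\<bar>\<dots>\<bar> \<le> C_norm l (s - ?p)" by (intro integral_le_C_norm C_space_diff s p')
    finally show ?thesis .
  qed
  hence "\<bar>integral {0..1} s\<bar> \<le> 0" using s(2) by (intro LIMSEQ_le_const[of _ 0]) auto
  hence "s \<in> C_space0 l" using s by (simp add: C_space0_def)
  thus ?thesis using s by blast
qed

section \<open>Sums over the branches\<close>

text \<open>The transfer operator of the Gauss map is \<open>branch_sum 2\<close>.  The family in \<open>s\<close> is closed under
  differentiation, which gives all derivatives of \<open>L0 f\<close> at once.\<close>

definition branch_sum :: "nat \<Rightarrow> (real \<Rightarrow> real) \<Rightarrow> real \<Rightarrow> real" where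
  "branch_sum s f x = (\<Sum>n. f (1 / (real n + 1 + x)) / (real n + 1 + x) ^ s)"

definition zeta2 :: real where
  "zeta2 = (\<Sum>n. 1 / (real n + 1)\<^sup>2)"

lemma summable_zeta2: "summable (\<lambda>n. 1 / (real n + 1)\<^sup>2)"
proof -
  have "summable (\<lambda>n. inverse (real (Suc n) ^ 2))"
    using inverse_power_summable[of 2, where 'a = real]
      summable_Suc_iff[of "\<lambda>n. inverse (real n ^ 2)"] by simp
  thus ?thesis by (simp add: field_simps)
qed

lemma branch_in: "x \<in> {0..1} \<Longrightarrow> 1 / (real n + 1 + x) \<in> {0..1}"
  by (auto simp: divide_le_eq)

lemma branch_term_bound:
  assumes "2 \<le> s" "\<And>y. y \<in> {0..1} \<Longrightarrow> \<bar>f y\<bar> \<le> c" "x \<in> {0..1}"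
  shows "\<bar>f (1 / (real n + 1 + x)) / (real n + 1 + x) ^ s\<bar> \<le> c * (1 / (real n + 1)\<^sup>2)"
proof -
  have "(real n + 1)\<^sup>2 \<le> (real n + 1 + x)\<^sup>2" using assms(3) by (intro power_mono) auto
  also have "\<dots> \<le> (real n + 1 + x) ^ s" using assms by (intro power_increasing) auto
  finally have le: "(real n + 1)\<^sup>2 \<le> (real n + 1 + x) ^ s" .
  have pos: "0 < (real n + 1)\<^sup>2" by simp
  have "\<bar>f (1 / (real n + 1 + x)) / (real n + 1 + x) ^ s\<bar>
      = \<bar>f (1 / (real n + 1 + x))\<bar> / (real n + 1 + x) ^ s"
    using assms(3) by (simp add: abs_divide)
  also have "\<dots> \<le> c / (real n + 1)\<^sup>2"
    using assms(2)[OF branch_in[OF assms(3)]] by (intro frac_le le pos order_trans[OF abs_ge_zero]) auto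
  finally show ?thesis by simp
qed

lemma branch_sum_summable:
  assumes "2 \<le> s" "\<And>y. y \<in> {0..1} \<Longrightarrow> \<bar>f y\<bar> \<le> c" "x \<in> {0..1}"
  shows "summable (\<lambda>n. \<bar>f (1 / (real n + 1 + x)) / (real n + 1 + x) ^ s\<bar>)"
    and "summable (\<lambda>n. f (1 / (real n + 1 + x)) / (real n + 1 + x) ^ s)"
proof -
  show *: "summable (\<lambda>n. \<bar>f (1 / (real n + 1 + x)) / (real n + 1 + x) ^ s\<bar>)"
    by (rule summable_comparison_test'[OF summable_mult[OF summable_zeta2, of c]])
       (use branch_term_bound[of s f c x, OF assms] in auto)
  show "summable (\<lambda>n. f (1 / (real n + 1 + x)) / (real n + 1 + x) ^ s)"
    using * by (rule summable_rabs_cancel)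
qed

lemma branch_sum_bound:
  assumes "2 \<le> s" "\<And>y. y \<in> {0..1} \<Longrightarrow> \<bar>f y\<bar> \<le> c" "x \<in> {0..1}"
  shows "\<bar>branch_sum s f x\<bar> \<le> zeta2 * c"
proof -
  have "\<bar>branch_sum s f x\<bar> \<le> (\<Sum>n. \<bar>f (1 / (real n + 1 + x)) / (real n + 1 + x) ^ s\<bar>)"
    unfolding branch_sum_def by (rule summable_rabs[OF branch_sum_summable(1)[of s f c x, OF assms]])
  also have "\<dots> \<le> (\<Sum>n. c * (1 / (real n + 1)\<^sup>2))"
    by (intro suminf_le branch_term_bound[of s f c x, OF assms] branch_sum_summable(1)[of s f c x, OF assms]
        summable_mult summable_zeta2)
  also have "\<dots> = zeta2 * c"
    unfolding zeta2_def by (subst suminf_mult[OF summable_zeta2]) simp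
  finally show ?thesis .
qed

lemma continuous_bounded01:
  assumes "continuous_on {0..1::real} f"
  obtains c where "\<And>y. y \<in> {0..1} \<Longrightarrow> \<bar>f y :: real\<bar> \<le> c"
  using le_sup01[OF assms] by blast

lemma branch_deriv:
  assumes f: "\<And>y. y \<in> {0..1} \<Longrightarrow> (f has_real_derivative f' y) (at y within {0..1})"
    and x: "x \<in> {0..1}"
  shows "((\<lambda>x. f (1 / (real n + 1 + x))) has_real_derivative
           - f' (1 / (real n + 1 + x)) / (real n + 1 + x)\<^sup>2) (at x within {0..1})"
proof -
  let ?V = "\<lambda>x. 1 / (real n + 1 + x)"
  have V: "(?V has_real_derivative (- 1 / (real n + 1 + x)\<^sup>2)) (at x within {0..1})"
    using x by (auto intro!: derivative_eq_intros simp: power2_eq_square)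
  have "(f has_real_derivative f' (?V x)) (at (?V x) within ?V ` {0..1})"
    by (rule has_field_derivative_subset[OF f[OF branch_in[OF x]]]) (use branch_in in blast)
  from DERIV_image_chain[OF this V] show ?thesis by (simp add: o_def)
qed

lemma branch_sum_deriv:
  assumes f: "\<And>y. y \<in> {0..1} \<Longrightarrow> (f has_real_derivative f' y) (at y within {0..1})"
    and f': "continuous_on {0..1} f'" and s: "2 \<le> s" and x: "x \<in> {0..1}"
  shows "(branch_sum s f has_real_derivative
           - real s * branch_sum (s + 1) f x - branch_sum (s + 2) f' x) (at x within {0..1})"
proof -
  have "continuous_on {0..1} f"
    unfolding continuous_on_eq_continuous_within by (auto intro: DERIV_continuous f)
  then obtain c where c: "\<And>y. y \<in> {0..1} \<Longrightarrow> \<bar>f y\<bar> \<le> c" using continuous_bounded01 by blast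
  obtain c' where c': "\<And>y. y \<in> {0..1} \<Longrightarrow> \<bar>f' y\<bar> \<le> c'" using continuous_bounded01[OF f'] by blast
  define u' where "u' n x = - real s * (f (1 / (real n + 1 + x)) / (real n + 1 + x) ^ (s + 1))
      - f' (1 / (real n + 1 + x)) / (real n + 1 + x) ^ (s + 2)" for n x
  have "((\<lambda>x. \<Sum>n. f (1 / (real n + 1 + x)) / (real n + 1 + x) ^ s) has_real_derivative
           (\<Sum>n. u' n x)) (at x within {0..1})"
  proof (rule series_deriv[where m = "\<lambda>n. real s * (c * (1 / (real n + 1)\<^sup>2)) + c' * (1 / (real n + 1)\<^sup>2)"])
    fix n and x :: real assume x: "x \<in> {0..1}"
    define y where "y = real n + 1 + x"
    have y: "y > 0" using x by (simp add: y_def)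
    have "((\<lambda>x. f (1 / (real n + 1 + x)) / (real n + 1 + x) ^ s) has_real_derivative
        ((- f' (1 / y) / y\<^sup>2) * y ^ s - f (1 / y) * (real s * y ^ (s - 1))) / (y ^ s * y ^ s))
        (at x within {0..1})"
      unfolding y_def using x y[unfolded y_def]
      by (auto intro!: derivative_eq_intros branch_deriv[OF f, THEN DERIV_cong])
    moreover have "((- f' (1 / y) / y\<^sup>2) * y ^ s - f (1 / y) * (real s * y ^ (s - 1))) / (y ^ s * y ^ s)
        = u' n x"
    proof -
      have "y ^ s = y * y ^ (s - 1)" using s by (cases s) auto
      thus ?thesis using y unfolding u'_def y_def[symmetric]
        by (simp add: field_simps power_add power2_eq_square)
    qed
    ultimately show "((\<lambda>x. f (1 / (real n + 1 + x)) / (real n + 1 + x) ^ s) has_real_derivative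
        u' n x) (at x within {0..1})" by simp
    have "\<bar>u' n x\<bar> \<le> real s * \<bar>f (1 / (real n + 1 + x)) / (real n + 1 + x) ^ (s + 1)\<bar>
        + \<bar>f' (1 / (real n + 1 + x)) / (real n + 1 + x) ^ (s + 2)\<bar>"
      unfolding u'_def by (rule order_trans[OF abs_triangle_ineq4]) (simp add: abs_mult)
    also have "\<dots> \<le> real s * (c * (1 / (real n + 1)\<^sup>2)) + c' * (1 / (real n + 1)\<^sup>2)"
      using s by (intro add_mono mult_left_mono branch_term_bound c c' x) auto
    finally show "\<bar>u' n x\<bar> \<le> real s * (c * (1 / (real n + 1)\<^sup>2)) + c' * (1 / (real n + 1)\<^sup>2)" .
  next
    show "summable (\<lambda>n. real s * (c * (1 / (real n + 1)\<^sup>2)) + c' * (1 / (real n + 1)\<^sup>2))"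
      by (intro summable_add summable_mult summable_zeta2)
    show "summable (\<lambda>n. f (1 / (real n + 1 + 0)) / (real n + 1 + 0) ^ s)"
      by (rule branch_sum_summable(2)[OF s c]) auto
  qed fact
  moreover have "(\<Sum>n. u' n x) = - real s * branch_sum (s + 1) f x - branch_sum (s + 2) f' x"
    unfolding u'_def branch_sum_def using s
    by (intro sums_unique[symmetric] sums_diff sums_mult summable_sums
        branch_sum_summable(2)[where f = f and c = c, OF _ c x]
        branch_sum_summable(2)[where f = f' and c = c', OF _ c' x]) auto
  ultimately show ?thesis unfolding branch_sum_def[abs_def] by simp
qed

lemma branch_sum_continuous:
  assumes f: "continuous_on {0..1} f" and s: "2 \<le> s"
  shows "continuous_on {0..1} (branch_sum s f)"
proof -
  obtain c where c: "\<And>y. y \<in> {0..1} \<Longrightarrow> \<bar>f y\<bar> \<le> c" using continuous_bounded01[OF f] by blast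
  have "uniform_limit {0..1} (\<lambda>n x. \<Sum>i<n. f (1 / (real i + 1 + x)) / (real i + 1 + x) ^ s)
      (branch_sum s f) sequentially"
    unfolding branch_sum_def[abs_def]
    by (rule Weierstrass_m_test[OF _ summable_mult[OF summable_zeta2, of c]])
       (use branch_term_bound[of s f c, OF s c] in auto)
  moreover have "continuous_on {0..1} (\<lambda>x. f (1 / (real i + 1 + x)) / (real i + 1 + x) ^ s)" for i
  proof -
    have "continuous_on {0..1} (\<lambda>x. f (1 / (real i + 1 + x)))"
    proof (rule continuous_on_compose2[OF f])
      show "continuous_on {0..1} (\<lambda>x. 1 / (real i + 1 + x))" by (intro continuous_intros) auto
      show "(\<lambda>x. 1 / (real i + 1 + x)) ` {0..1} \<subseteq> {0..1}" using branch_in by blast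
    qed
    thus ?thesis by (intro continuous_intros) auto
  qed
  ultimately show ?thesis
    by (intro uniform_limit_theorem[rotated]) (auto intro!: always_eventually continuous_on_sum)
qed

text \<open>The coefficients that arise when the rule \<open>branch_sum_deriv\<close> is applied \<open>j\<close> times to
  \<open>branch_sum 2 f\<close>, up to the sign: \<open>leibniz j i\<close> belongs to the \<open>i\<close>-th derivative of \<open>f\<close>.\<close>

primrec leibniz :: "nat \<Rightarrow> nat \<Rightarrow> real" where
  "leibniz 0 i = (if i = 0 then 1 else 0)"
| "leibniz (Suc j) i = real (2 + j + i) * leibniz j i + (case i of 0 \<Rightarrow> 0 | Suc k \<Rightarrow> leibniz j k)"

lemma leibniz_zero: "j < i \<Longrightarrow> leibniz j i = 0"
  by (induction j arbitrary: i) (auto split: nat.split)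

lemma leibniz_diag: "leibniz j j = 1"
  by (induction j) (auto simp: leibniz_zero)

lemma leibniz_nonneg: "0 \<le> leibniz j i"
  by (induction j arbitrary: i) (auto split: nat.split)

definition branch_jet :: "(nat \<Rightarrow> real \<Rightarrow> real) \<Rightarrow> nat \<Rightarrow> real \<Rightarrow> real" where
  "branch_jet F j x = (- 1) ^ j * (\<Sum>i\<le>j. leibniz j i * branch_sum (2 + j + i) (F i) x)"

lemma jet_branch_jet:
  assumes F: "jet l F"
  shows "jet l (branch_jet F)"
proof (rule jetI)
  fix j x assume j: "j < l" and x: "x \<in> {0..1::real}"
  define d where "d i = - real (2 + j + i) * branch_sum (2 + j + i + 1) (F i) x
      - branch_sum (2 + j + i + 2) (F (Suc i)) x" for i
  have d: "(branch_sum (2 + j + i) (F i) has_real_derivative d i) (at x within {0..1})" if "i \<le> j" for i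
    unfolding d_def using j that
    by (intro branch_sum_deriv jetD[OF F] jet_continuous[OF F] x) auto
  have "(branch_jet F j has_real_derivative (- 1) ^ j * (\<Sum>i\<le>j. leibniz j i * d i)) (at x within {0..1})"
    unfolding branch_jet_def[abs_def] by (intro DERIV_cmult DERIV_sum d) auto
  moreover have "(- 1) ^ j * (\<Sum>i\<le>j. leibniz j i * d i) = branch_jet F (Suc j) x"
  proof -
    let ?b = "\<lambda>i. branch_sum (2 + Suc j + i) (F i) x"
    have "(\<Sum>i\<le>Suc j. leibniz (Suc j) i * ?b i)
        = (\<Sum>i\<le>Suc j. real (2 + j + i) * leibniz j i * ?b i)
          + (\<Sum>i\<le>Suc j. (case i of 0 \<Rightarrow> 0 | Suc k \<Rightarrow> leibniz j k) * ?b i)"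
      by (simp only: leibniz.simps distrib_right sum.distrib)
    also have "(\<Sum>i\<le>Suc j. real (2 + j + i) * leibniz j i * ?b i)
        = (\<Sum>i\<le>j. real (2 + j + i) * leibniz j i * ?b i)"
      by (simp add: leibniz_zero)
    also have "(\<Sum>i\<le>Suc j. (case i of 0 \<Rightarrow> 0 | Suc k \<Rightarrow> leibniz j k) * ?b i)
        = (\<Sum>i\<le>j. leibniz j i * ?b (Suc i))"
      by (subst sum.atMost_Suc_shift) simp
    finally have "(\<Sum>i\<le>Suc j. leibniz (Suc j) i * ?b i)
        = - (\<Sum>i\<le>j. leibniz j i * d i)"
      by (simp add: d_def sum_negf[symmetric] sum.distrib[symmetric] algebra_simps)
    thus ?thesis by (simp add: branch_jet_def)
  qed
  ultimately show "(branch_jet F j has_real_derivative branch_jet F (Suc j) x) (at x within {0..1})"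
    by simp
next
  show "continuous_on {0..1} (branch_jet F l)"
    unfolding branch_jet_def[abs_def]
    by (intro continuous_intros branch_sum_continuous jet_continuous[OF F]) auto
qed

section \<open>The two transfer operators on \<open>C\<^sup>l([0,1])\<close>\<close>

lemma transfer_eq_suminf:
  assumes x: "x \<in> {0..1}"
    and V: "\<And>n. \<bar>deriv (V (Suc n)) x\<bar> = 1 / (real n + 1 + x)\<^sup>2"
    and g: "\<And>n. f (V (Suc n) x) = g (1 / (real n + 1 + x))"
    and bd: "\<And>y. y \<in> {0..1} \<Longrightarrow> \<bar>g y\<bar> \<le> c"
  shows "transfer V f x = branch_sum 2 g x"
proof -
  define t where "t a = \<bar>deriv (V a) x\<bar> * f (V a x)" for a
  have tS: "t (Suc n) = g (1 / (real n + 1 + x)) / (real n + 1 + x)\<^sup>2" for n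
    by (simp add: t_def V g)
  have "(\<Sum>\<^sub>\<infinity>a\<in>{1..}. t a) = (\<Sum>\<^sub>\<infinity>a\<in>range Suc. t a)"
    by (rule arg_cong[of _ _ "infsum t"]) (auto simp: image_iff Suc_le_eq gr0_conv_Suc)
  also have "\<dots> = (\<Sum>\<^sub>\<infinity>n. t (Suc n))"
    by (subst infsum_reindex) (auto simp: o_def)
  also have "\<dots> = (\<Sum>n. t (Suc n))"
    by (rule infsumI, rule norm_summable_imp_has_sum)
       (use branch_sum_summable[of 2 g c, OF _ bd x] in \<open>simp_all add: tS summable_sums\<close>)
  finally show ?thesis using x by (simp add: transfer_def t_def[symmetric] branch_sum_def tS)
qed

lemma L0_outside: "x \<notin> {0..1} \<Longrightarrow> L0 f x = 0" and L1_outside: "x \<notin> {0..1} \<Longrightarrow> L1 f x = 0"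
  by (auto simp: L0_def L1_def transfer_def)

lemma L0_eq:
  assumes "x \<in> {0..1}" and "continuous_on {0..1} f"
  shows "L0 f x = branch_sum 2 f x"
proof -
  obtain c where c: "\<And>y. y \<in> {0..1} \<Longrightarrow> \<bar>f y\<bar> \<le> c" using continuous_bounded01[OF assms(2)] by blast
  have "deriv (gauss_inv_branch (Suc n)) x = - 1 / (real n + 1 + x)\<^sup>2" for n
    unfolding gauss_inv_branch_def[abs_def] using assms(1)
    by (intro DERIV_imp_deriv) (auto intro!: derivative_eq_intros simp: power2_eq_square add_ac)
  thus ?thesis unfolding L0_def
    by (intro transfer_eq_suminf[OF assms(1) _ _ c]) (auto simp: gauss_inv_branch_def add_ac)
qed

definition reflect :: "(real \<Rightarrow> real) \<Rightarrow> real \<Rightarrow> real" where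
  "reflect f x = f (1 - x)"

lemma reflect_continuous: "continuous_on {0..1} f \<Longrightarrow> continuous_on {0..1} (reflect f)"
  unfolding reflect_def[abs_def] by (rule continuous_on_compose2[of "{0..1}"]) (auto intro!: continuous_intros)

text \<open>Since \<open>renyi_inv_branch a = 1 - gauss_inv_branch a\<close>, all properties of \<open>L1\<close> are inherited
  from those of \<open>L0\<close>.\<close>

lemma L1_eq:
  assumes "continuous_on {0..1} f"
  shows "L1 f = L0 (reflect f)"
proof
  fix x
  show "L1 f x = L0 (reflect f) x"
  proof (cases "x \<in> {0..1}")
    case True
    obtain c where c: "\<And>y. y \<in> {0..1} \<Longrightarrow> \<bar>reflect f y\<bar> \<le> c"
      using continuous_bounded01[OF reflect_continuous[OF assms]] by blast
    have "deriv (renyi_inv_branch (Suc n)) x = 1 / (real n + 1 + x)\<^sup>2" for n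
      unfolding renyi_inv_branch_def[abs_def] using True
      by (intro DERIV_imp_deriv) (auto intro!: derivative_eq_intros simp: power2_eq_square add_ac)
    hence "L1 f x = branch_sum 2 (reflect f) x"
      unfolding L1_def
      by (intro transfer_eq_suminf[OF True _ _ c]) (auto simp: renyi_inv_branch_def reflect_def add_ac)
    thus ?thesis using L0_eq[OF True reflect_continuous[OF assms]] by simp
  qed (simp add: L0_outside L1_outside)
qed

lemma reflect_C_space:
  assumes f: "f \<in> C_space l"
  shows "reflect f \<in> C_space l" and "C_norm l (reflect f) \<le> C_norm l f"
proof -
  define F where "F j x = (- 1) ^ j * (D01 ^^ j) f (1 - x)" for j x
  have jet: "jet l F"
  proof (rule jetI)
    fix j x assume j: "j < l" and x: "x \<in> {0..1::real}"
    have "((D01 ^^ j) f has_real_derivative (D01 ^^ Suc j) f (1 - x)) (at (1 - x) within (\<lambda>x. 1 - x) ` {0..1})"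
      by (rule has_field_derivative_subset[OF jetD[OF C_space_jet[OF f] j]]) (use x in auto)
    moreover have "((\<lambda>x. 1 - x) has_real_derivative - 1) (at x within {0..1})"
      by (auto intro!: derivative_eq_intros)
    ultimately have "((\<lambda>x. (D01 ^^ j) f (1 - x)) has_real_derivative (D01 ^^ Suc j) f (1 - x) * - 1)
        (at x within {0..1})"
      using DERIV_image_chain by (force simp: o_def)
    from DERIV_cmult[OF this, of "(- 1) ^ j"]
    show "(F j has_real_derivative F (Suc j) x) (at x within {0..1})"
      by (simp add: F_def[abs_def])
  next
    show "continuous_on {0..1} (F l)"
      unfolding F_def using reflect_continuous[OF C_space_continuous[OF f order_refl]]
      by (intro continuous_intros) (simp add: reflect_def[abs_def])
  qed
  have eq: "reflect f x = F 0 x" for x by (simp add: F_def reflect_def)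
  show "reflect f \<in> C_space l"
    by (rule C_spaceI[OF _ jet eq]) (use C_space_outside[OF f] in \<open>auto simp: reflect_def\<close>)
  show "C_norm l (reflect f) \<le> C_norm l f"
    unfolding C_norm_sup01
  proof (intro sum_mono sup01_le)
    fix j x assume "j \<in> {..l}" "x \<in> {0..1::real}"
    thus "\<bar>(D01 ^^ j) (reflect f) x\<bar> \<le> sup01 ((D01 ^^ j) f)"
      using le_sup01[OF C_space_continuous[OF f], of j "1 - x"]
      by (simp add: jet_D01[OF jet eq] F_def abs_mult)
  qed
qed

lemma reflect_integral:
  assumes "continuous_on {0..1} f"
  shows "integral {0..1} (reflect f) = integral {0..1} f"
proof -
  have "(f has_integral integral {0..1} f) (cbox 0 1)"
    using integrable_integral[OF integrable_continuous_real[OF assms]] by simp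
  from has_integral_affinity[OF this, of "- 1" 1]
  have "(reflect f has_integral integral {0..1} f) {0..1}"
    by (simp add: reflect_def[abs_def] image_affinity_atLeastAtMost_diff flip: diff_conv_add_uminus)
  thus ?thesis by (rule integral_unique)
qed

lemma
  assumes f: "f \<in> C_space l"
  shows L0_in_C_space: "L0 f \<in> C_space l"
    and D01_L0: "j \<le> l \<Longrightarrow> x \<in> {0..1} \<Longrightarrow> (D01 ^^ j) (L0 f) x = branch_jet (\<lambda>j. (D01 ^^ j) f) j x"
proof -
  note jet = jet_branch_jet[OF C_space_jet[OF f]]
  have eq: "L0 f x = branch_jet (\<lambda>j. (D01 ^^ j) f) 0 x" if "x \<in> {0..1}" for x
    using L0_eq[OF that C_space_continuous0[OF f]] by (simp add: branch_jet_def)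
  show "L0 f \<in> C_space l"
    by (rule C_spaceI[OF _ jet eq]) (rule L0_outside)
  show "j \<le> l \<Longrightarrow> x \<in> {0..1} \<Longrightarrow> (D01 ^^ j) (L0 f) x = branch_jet (\<lambda>j. (D01 ^^ j) f) j x"
    by (rule jet_D01[OF jet eq])
qed

lemma L1_in_C_space:
  assumes "f \<in> C_space l"
  shows "L1 f \<in> C_space l"
  using L0_in_C_space[OF reflect_C_space(1)[OF assms]] L1_eq[OF C_space_continuous0[OF assms]] by simp

lemma branch_sum_lincomb:
  assumes f: "continuous_on {0..1} f" and g: "continuous_on {0..1} g" and s: "2 \<le> s" and x: "x \<in> {0..1}"
  shows "branch_sum s (\<lambda>x. a * f x + b * g x) x = a * branch_sum s f x + b * branch_sum s g x"
proof -
  obtain c where c: "\<And>y. y \<in> {0..1} \<Longrightarrow> \<bar>f y\<bar> \<le> c" using continuous_bounded01[OF f] by blast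
  obtain d where d: "\<And>y. y \<in> {0..1} \<Longrightarrow> \<bar>g y\<bar> \<le> d" using continuous_bounded01[OF g] by blast
  have "(\<lambda>n. a * (f (1 / (real n + 1 + x)) / (real n + 1 + x) ^ s)
        + b * (g (1 / (real n + 1 + x)) / (real n + 1 + x) ^ s)) sums
      (a * branch_sum s f x + b * branch_sum s g x)"
    unfolding branch_sum_def using s
    by (intro sums_add sums_mult summable_sums branch_sum_summable(2)[where f = f and c = c, OF _ c x]
        branch_sum_summable(2)[where f = g and c = d, OF _ d x])
  thus ?thesis unfolding branch_sum_def by (simp add: sums_iff add_divide_distrib)
qed

lemma L0_lincomb:
  assumes "continuous_on {0..1} f" "continuous_on {0..1} g"
  shows "L0 (a *\<^sub>R f + b *\<^sub>R g) = a *\<^sub>R L0 f + b *\<^sub>R L0 g"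
proof
  fix x
  have cont: "continuous_on {0..1} (a *\<^sub>R f + b *\<^sub>R g)"
    unfolding plus_fun_def scaleR_fun_def by (intro continuous_intros assms)
  show "L0 (a *\<^sub>R f + b *\<^sub>R g) x = (a *\<^sub>R L0 f + b *\<^sub>R L0 g) x"
  proof (cases "x \<in> {0..1}")
    case True
    have "L0 (a *\<^sub>R f + b *\<^sub>R g) x = branch_sum 2 (\<lambda>x. a * f x + b * g x) x"
      unfolding L0_eq[OF True cont] by (simp add: plus_fun_def scaleR_fun_def)
    also have "\<dots> = a * L0 f x + b * L0 g x"
      unfolding L0_eq[OF True assms(1)] L0_eq[OF True assms(2)]
      by (rule branch_sum_lincomb[OF assms _ True]) simp
    finally show ?thesis by simp
  next
    case False
    thus ?thesis using L0_outside[OF False] by simp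
  qed
qed

lemma L1_lincomb:
  assumes "continuous_on {0..1} f" "continuous_on {0..1} g"
  shows "L1 (a *\<^sub>R f + b *\<^sub>R g) = a *\<^sub>R L1 f + b *\<^sub>R L1 g"
proof -
  have cont: "continuous_on {0..1} (a *\<^sub>R f + b *\<^sub>R g)"
    unfolding plus_fun_def scaleR_fun_def by (intro continuous_intros assms)
  have "reflect (a *\<^sub>R f + b *\<^sub>R g) = a *\<^sub>R reflect f + b *\<^sub>R reflect g"
    by (simp add: reflect_def fun_eq_iff)
  thus ?thesis unfolding L1_eq[OF cont] L1_eq[OF assms(1)] L1_eq[OF assms(2)]
    using L0_lincomb[OF reflect_continuous[OF assms(1)] reflect_continuous[OF assms(2)]] by metis
qed

text \<open>Summing \<open>F (1 / a) - F (V\<^sub>a x)\<close> over the branches, \<open>F\<close> an antiderivative of \<open>f\<close>, gives an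
  antiderivative of \<open>L0 f\<close>; at \<open>x = 1\<close> the sum telescopes to \<open>F 1 - F 0\<close>.\<close>

lemma L0_integral:
  assumes f: "continuous_on {0..1} f"
  shows "integral {0..1} (L0 f) = integral {0..1} f"
proof -
  obtain c where c: "\<And>y. y \<in> {0..1} \<Longrightarrow> \<bar>f y\<bar> \<le> c" using continuous_bounded01[OF f] by blast
  define F where "F x = integral {0..x} f" for x
  have F: "(F has_real_derivative f x) (at x within {0..1})" if "x \<in> {0..1}" for x
    unfolding F_def[abs_def] by (rule integral_has_real_derivative[OF f that])
  define G where "G x = (\<Sum>n. F (1 / (real n + 1)) - F (1 / (real n + 1 + x)))" for x
  have "(G has_real_derivative L0 f x) (at x within {0..1})" if x: "x \<in> {0..1}" for x
    unfolding L0_eq[OF x f] branch_sum_def G_def[abs_def]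
  proof (rule series_deriv[OF _ branch_term_bound[of 2 f c, OF _ c] summable_mult[OF summable_zeta2] _ x])
    fix n x assume x: "x \<in> {0..1::real}"
    show "((\<lambda>x. F (1 / (real n + 1)) - F (1 / (real n + 1 + x))) has_real_derivative
       f (1 / (real n + 1 + x)) / (real n + 1 + x)\<^sup>2) (at x within {0..1})"
      by (rule DERIV_cong[OF DERIV_diff[OF DERIV_const branch_deriv[OF F x]]]) simp_all
  qed auto
  hence "(L0 f has_integral G 1 - G 0) {0..1}"
    by (intro fundamental_theorem_of_calculus)
       (auto simp flip: has_real_derivative_iff_has_vector_derivative)
  hence "integral {0..1} (L0 f) = G 1 - G 0" by (rule integral_unique)
  also have "G 0 = 0" by (simp add: G_def)
  also have "G 1 = F 1 - F 0"
  proof -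
    have "continuous (at 0 within {0..1}) F" by (rule DERIV_continuous[OF F]) simp
    hence "continuous_on {0..1} F"
      unfolding continuous_on_eq_continuous_within by (auto intro: DERIV_continuous F)
    moreover have "(\<lambda>n. 1 / (real n + 1)) \<longlonglongrightarrow> 0"
      using LIMSEQ_inverse_real_of_nat by (simp add: inverse_eq_divide add_ac)
    ultimately have "(\<lambda>n. F (1 / (real n + 1))) \<longlonglongrightarrow> F 0"
      by (rule continuous_on_tendsto_compose) (auto simp: divide_le_eq)
    from telescope_sums'[OF this] show ?thesis by (simp add: G_def sums_iff add_ac)
  qed
  finally show ?thesis by (simp add: F_def)
qed

lemma L1_integral: "continuous_on {0..1} f \<Longrightarrow> integral {0..1} (L1 f) = integral {0..1} f"
  by (simp add: L1_eq L0_integral reflect_continuous reflect_integral)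

lemma L0_in_C_space0: "f \<in> C_space0 l \<Longrightarrow> L0 f \<in> C_space0 l"
  by (simp add: C_space0_def L0_in_C_space L0_integral C_space_continuous0[of f l])

lemma L1_in_C_space0: "f \<in> C_space0 l \<Longrightarrow> L1 f \<in> C_space0 l"
  by (simp add: C_space0_def L1_in_C_space L1_integral C_space_continuous0[of f l])

section \<open>The Gauss operator contracts on functions of zero average\<close>

text \<open>The transition probabilities \<open>p n = (1 + x) / (y (y + 1))\<close>, \<open>y = n + 1 + x\<close>, of the Gauss map
  have sum \<open>1\<close>, and the summands below are \<open>p n / y\<^sup>2\<close>.  Only the first branch, of probability
  \<open>1 / (2 + x)\<close>, contracts weakly; on all others \<open>1 / y\<^sup>2 \<le> 1 / 4\<close>.  This gives
  the bound \<open>1 / 2 + (1 / 2) (1 / 4) = 5 / 8\<close>.\<close>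

lemma branch_weights:
  assumes x: "x \<in> {0..1::real}"
  shows "(\<Sum>n<m. (1 + x) / ((real n + 1 + x) ^ 3 * (real n + 1 + x + 1))) \<le> 5 / 8"
proof -
  define p where "p n = (1 + x) / ((real n + 1 + x) * (real n + 1 + x + 1))" for n
  define w where "w n = (1 + x) / ((real n + 1 + x) ^ 3 * (real n + 1 + x + 1))" for n
  have w_nonneg: "0 \<le> w n" for n using x by (auto simp: w_def)
  have le: "w (Suc n) \<le> p (Suc n) / 4" for n
  proof -
    define y where "y = real (Suc n) + 1 + x"
    have y: "2 \<le> y" using x by (simp add: y_def)
    hence "2\<^sup>2 \<le> y\<^sup>2" by (intro power_mono) auto
    moreover have "w (Suc n) = p (Suc n) / y\<^sup>2"
      unfolding w_def p_def y_def[symmetric] by (simp add: power2_eq_square power3_eq_cube)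
    moreover have "0 \<le> p (Suc n)" using x by (auto simp: p_def)
    moreover from calculation have "p (Suc n) / y\<^sup>2 \<le> p (Suc n) / 4" by (intro divide_left_mono) auto
    ultimately show ?thesis by simp
  qed
  have tele: "p n = (1 + x) / (real n + 1 + x) - (1 + x) / (real (Suc n) + 1 + x)" for n
  proof -
    define y where "y = real n + 1 + x"
    have y: "0 < y" using x by (simp add: y_def)
    have eq: "real (Suc n) + 1 + x = y + 1" by (simp add: y_def)
    show ?thesis unfolding p_def eq unfolding y_def[symmetric] using y by (simp add: field_simps)
  qed
  have "(\<Sum>n<m. w n) \<le> (\<Sum>n<Suc m. w n)" using w_nonneg by simp
  also have "\<dots> = w 0 + (\<Sum>n<m. w (Suc n))" by (rule sum.lessThan_Suc_shift)
  also have "(\<Sum>n<m. w (Suc n)) \<le> (\<Sum>n<m. p (Suc n) / 4)" by (intro sum_mono le)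
  also have "\<dots> = (\<Sum>n<m. p (Suc n)) / 4" by (simp add: sum_divide_distrib)
  also have "(\<Sum>n<m. p (Suc n)) = (1 + x) / (2 + x) - (1 + x) / (real (Suc m) + 1 + x)"
    unfolding tele
    by (subst sum_lessThan_telescope'[where f = "\<lambda>n. (1 + x) / (real (Suc n) + 1 + x)"]) simp
  also have "\<dots> \<le> (1 + x) / (2 + x)" using x by simp
  also have "w 0 + (1 + x) / (2 + x) / 4 \<le> 5 / 8"
  proof -
    have "w 0 = 1 / (1 + x)\<^sup>2 / (2 + x)"
      using x by (simp add: w_def power2_eq_square power3_eq_cube add_ac)
    also have "1 / (1 + x)\<^sup>2 \<le> 1" using x by (simp add: divide_le_eq power2_eq_square algebra_simps)
    finally have "w 0 \<le> 1 / (2 + x)" using x by (simp add: divide_right_mono)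
    moreover have "1 / (2 + x) + (1 + x) / (2 + x) / 4 = (1 + (1 + x) / 4) / (2 + x)"
      by (metis add_divide_distrib divide_divide_eq_left mult.commute)
    moreover have "\<dots> \<le> 5 / 8" using x by (simp add: divide_le_eq)
    ultimately show ?thesis by linarith
  qed
  finally show ?thesis by (simp add: w_def)
qed

text \<open>Comparison with \<open>1 / ((n + 1) (n + 2) (n + 3))\<close>, which telescopes.\<close>

lemma cubes_sum: "(\<Sum>n<m. 1 / (real n + 2) ^ 3) \<le> 1 / 4"
proof -
  have "(\<Sum>n<m. 1 / (real n + 2) ^ 3)
      \<le> (\<Sum>n<m. 1 / (2 * (real n + 1) * (real n + 2)) - 1 / (2 * (real (Suc n) + 1) * (real (Suc n) + 2)))"
  proof (rule sum_mono)
    fix n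
    define y where "y = real n + 2"
    have y: "2 \<le> y" by (simp add: y_def)
    have "1 / y ^ 3 \<le> 1 / ((y - 1) * y * (y + 1))"
      using y by (intro divide_left_mono mult_pos_pos) (auto simp: power3_eq_cube algebra_simps)
    also have "\<dots> = 1 / (2 * (y - 1) * y) - 1 / (2 * y * (y + 1))"
      using y by (simp add: divide_simps)
    finally show "1 / (real n + 2) ^ 3
        \<le> 1 / (2 * (real n + 1) * (real n + 2)) - 1 / (2 * (real (Suc n) + 1) * (real (Suc n) + 2))"
      by (simp add: y_def add_ac)
  qed
  also have "\<dots> = 1 / 4 - 1 / (2 * (real m + 1) * (real m + 2))"
    by (subst sum_lessThan_telescope'[where f = "\<lambda>n. 1 / (2 * (real n + 1) * (real n + 2))"]) auto
  also have "\<dots> \<le> 1 / 4" by simp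
  finally show ?thesis .
qed

lemma abel_sum:
  fixes T g :: "nat \<Rightarrow> real"
  shows "(\<Sum>n<m. (T n - T (Suc n)) * g n)
    = T 0 * g 0 - T m * g m + (\<Sum>n<m. T (Suc n) * (g (Suc n) - g n))"
  by (induction m) (auto simp: algebra_simps)

text \<open>The summand of \<open>((1 + x) (L0 f)(x))'\<close> in terms of \<open>(1 + v) F\<close> and its derivative \<open>F + (1 + v) D\<close>,
  at \<open>v = 1 / y\<close>.\<close>

lemma branch_term_identity:
  fixes y b F D :: real
  assumes "1 \<le> y"
  shows "F / y ^ 2 + b * (- 2 * (F / y ^ 3) - D / y ^ 4)
    = ((y - b) / y\<^sup>2 - (y + 1 - b) / (y + 1)\<^sup>2) * ((1 + 1 / y) * F)
      - b / (y ^ 3 * (y + 1)) * (F + (1 + 1 / y) * D)"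
proof -
  define z where "z = y + 1"
  have nz: "y \<noteq> 0" "z \<noteq> 0" and b: "1 + 1 / y = z / y" using assms by (auto simp: z_def divide_simps)
  have D: "b / y ^ 4 = b / (y ^ 3 * z) * (z / y)"
    using nz by (simp add: power3_eq_cube power4_eq_xxxx)
  have "((y - b) / y\<^sup>2 - (z - b) / z\<^sup>2) * (z / y) - b / (y ^ 3 * z)
      = ((y - b) * z\<^sup>2 - (z - b) * y\<^sup>2 - b) / (y ^ 3 * z)"
    using nz by (simp add: divide_simps) (simp add: algebra_simps power2_eq_square power3_eq_cube)
  also have "(y - b) * z\<^sup>2 - (z - b) * y\<^sup>2 - b = (y - 2 * b) * z"
    by (simp add: z_def algebra_simps power2_eq_square)
  also have "\<dots> / (y ^ 3 * z) = 1 / y\<^sup>2 - 2 * b / y ^ 3"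
    using nz by (simp add: diff_divide_distrib power2_eq_square power3_eq_cube)
  finally have F: "1 / y\<^sup>2 - 2 * b / y ^ 3
      = ((y - b) / y\<^sup>2 - (z - b) / z\<^sup>2) * (z / y) - b / (y ^ 3 * z)" ..
  have "F / y ^ 2 + b * (- 2 * (F / y ^ 3) - D / y ^ 4) = (1 / y\<^sup>2 - 2 * b / y ^ 3) * F - b / y ^ 4 * D"
    by (simp add: algebra_simps)
  also have "\<dots> = ((y - b) / y\<^sup>2 - (z - b) / z\<^sup>2) * (z / y * F) - b / (y ^ 3 * z) * (F + z / y * D)"
    unfolding F D by (simp only: left_diff_distrib right_diff_distrib distrib_left distrib_right mult.assoc
        add.assoc diff_diff_eq)
  finally show ?thesis unfolding b z_def .
qed

text \<open>The derivative of \<open>(1 + x) f(x)\<close>.  Up to a constant, the function \<open>(1 + x) f(x)\<close> is the density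
  of the measure \<open>f dx\<close> with respect to the Gauss measure.\<close>

definition gauss_deriv :: "(real \<Rightarrow> real) \<Rightarrow> real \<Rightarrow> real" where
  "gauss_deriv f x = f x + (1 + x) * D01 f x"

context
  fixes f :: "real \<Rightarrow> real"
  assumes f: "f \<in> C_space 1"
begin

lemma gauss_deriv:
  "x \<in> {0..1} \<Longrightarrow> ((\<lambda>x. (1 + x) * f x) has_real_derivative gauss_deriv f x) (at x within {0..1})"
  using jetD[OF C_space_jet[OF f], of 0 x]
  by (auto intro!: derivative_eq_intros simp: gauss_deriv_def algebra_simps)

lemma gauss_deriv_continuous: "continuous_on {0..1} (gauss_deriv f)"
  unfolding gauss_deriv_def[abs_def]
  using C_space_continuous[OF f, of 1] C_space_continuous0[OF f] by (intro continuous_intros) auto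

lemma gauss_deriv_lipschitz:
  assumes "x \<in> {0..1}" "y \<in> {0..1}"
  shows "\<bar>(1 + x) * f x - (1 + y) * f y\<bar> \<le> sup01 (gauss_deriv f) * \<bar>x - y\<bar>"
  using field_differentiable_bound[of "{0..1}" "\<lambda>x. (1 + x) * f x" "gauss_deriv f"
      "sup01 (gauss_deriv f)" x y] gauss_deriv le_sup01[OF gauss_deriv_continuous] assms
  by simp

text \<open>For \<open>g(x) = (1 + x) f(x)\<close> one has \<open>(1 + x) (L0 f)(x) = \<Sum>\<^sub>n p\<^sub>n(x) g(1 / (n + 1 + x))\<close> with the
  transition probabilities \<open>p\<^sub>n\<close>.  Differentiating \<open>g\<close> gives at most \<open>5 / 8\<close> of the supremum of
  the derivative of \<open>g\<close>, by \<open>branch_weights\<close>.  Differentiating \<open>p\<^sub>n\<close> gives values of \<open>g\<close> itself, but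
  the derivatives of the \<open>p\<^sub>n\<close> have sum \<open>0\<close>: Abel summation turns this part into a sum of
  increments of \<open>g\<close> between neighbouring branches, which is at most \<open>1 / 4\<close> of the same supremum, by
  \<open>cubes_sum\<close>.\<close>

lemma gauss_deriv_contraction: "sup01 (gauss_deriv (L0 f)) \<le> 7 / 8 * sup01 (gauss_deriv f)"
proof (rule sup01_le)
  fix x :: real assume x: "x \<in> {0..1}"
  define B where "B = sup01 (gauss_deriv f)"
  define y where "y n = real n + 1 + x" for n
  define g where "g n = (1 + 1 / y n) * f (1 / y n)" for n
  define g' where "g' n = gauss_deriv f (1 / y n)" for n
  \<comment> \<open>\<open>T n\<close> is the derivative of the tail \<open>(1 + x) / (n + 1 + x)\<close> of the transition probabilities.\<close>
  define T where "T n = real n / (y n)\<^sup>2" for n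
  define w where "w n = (1 + x) / (y n ^ 3 * (y n + 1))" for n
  define t where "t n = f (1 / y n) / y n ^ 2 + (1 + x) * (- 2 * (f (1 / y n) / y n ^ 3)
      - D01 f (1 / y n) / y n ^ 4)" for n
  have y: "1 \<le> y n" "y (Suc n) = y n + 1" for n using x by (auto simp: y_def)
  have V: "1 / y n \<in> {0..1}" for n unfolding y_def by (rule branch_in[OF x])
  have cont: "continuous_on {0..1} f" "continuous_on {0..1} (D01 f)"
    using C_space_continuous0[OF f] C_space_continuous[OF f, of 1] by auto
  obtain c where c: "\<And>y. y \<in> {0..1} \<Longrightarrow> \<bar>f y\<bar> \<le> c" using continuous_bounded01[OF cont(1)] by blast
  obtain c' where c': "\<And>y. y \<in> {0..1} \<Longrightarrow> \<bar>D01 f y\<bar> \<le> c'" using continuous_bounded01[OF cont(2)] by blast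
  have B: "0 \<le> B" unfolding B_def by (intro sup01_nonneg gauss_deriv_continuous)
  have val: "gauss_deriv (L0 f) x
      = branch_sum 2 f x + (1 + x) * (- 2 * branch_sum 3 f x - branch_sum 4 (D01 f) x)"
  proof -
    have "D01 (L0 f) x = - 2 * branch_sum 3 f x - branch_sum 4 (D01 f) x"
      using D01_L0[OF f, of 1 x] x by (simp add: branch_jet_def)
    thus ?thesis using L0_eq[OF x cont(1)] by (simp add: gauss_deriv_def)
  qed
  have sums: "t sums gauss_deriv (L0 f) x"
    unfolding val t_def branch_sum_def y_def
    by (intro sums_add sums_mult sums_diff summable_sums
        branch_sum_summable(2)[where f = f and c = c, OF _ c x]
        branch_sum_summable(2)[where f = "D01 f" and c = c', OF _ c' x]) auto
  have t: "t n = (T n - T (Suc n)) * g n - w n * g' n" for n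
  proof -
    let ?f = "f (1 / y n)" and ?d = "D01 f (1 / y n)"
    have T1: "T n = (y n - (1 + x)) / (y n)\<^sup>2" "T (Suc n) = (y n - x) / (y n + 1)\<^sup>2"
      by (simp_all add: T_def y_def add_ac)
    show ?thesis unfolding t_def T1 g_def g'_def w_def gauss_deriv_def
      using branch_term_identity[OF y(1)[of n], of ?f "1 + x" ?d] by simp
  qed
  have part: "\<bar>\<Sum>n<m. t n\<bar> \<le> 2 * c * (1 / (real m + 1)) + 7 / 8 * B" for m
  proof -
    have "(\<Sum>n<m. t n) = - (T m * g m) + (\<Sum>n<m. T (Suc n) * (g (Suc n) - g n)) - (\<Sum>n<m. w n * g' n)"
      unfolding t sum_subtractf abel_sum by (simp add: T_def)
    moreover have "\<bar>- (T m * g m)\<bar> \<le> 2 * c * (1 / (real m + 1))"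
    proof -
      have "\<bar>g m\<bar> \<le> 2 * c"
        unfolding g_def abs_mult using c[OF V[of m]] V[of m] by (intro mult_mono) auto
      moreover have "T m \<le> 1 / (real m + 1)"
      proof -
        have "real m * (real m + 1) \<le> y m * y m" using x by (intro mult_mono) (auto simp: y_def)
        thus ?thesis using y(1)[of m] by (simp add: T_def divide_simps power2_eq_square)
      qed
      moreover have "0 \<le> T m" by (simp add: T_def)
      ultimately have "T m * \<bar>g m\<bar> \<le> (1 / (real m + 1)) * (2 * c)" by (intro mult_mono) auto
      thus ?thesis using \<open>0 \<le> T m\<close> by (simp add: abs_mult)
    qed
    moreover have "\<bar>\<Sum>n<m. T (Suc n) * (g (Suc n) - g n)\<bar> \<le> 1 / 4 * B"
    proof -
      have "\<bar>T (Suc n) * (g (Suc n) - g n)\<bar> \<le> 1 / (real n + 2) ^ 3 * B" for n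
      proof -
        have "\<bar>g (Suc n) - g n\<bar> \<le> B * \<bar>1 / y (Suc n) - 1 / y n\<bar>"
          unfolding g_def B_def by (rule gauss_deriv_lipschitz[OF V V])
        also have "1 / y (Suc n) - 1 / y n = - (1 / (y n * (y n + 1)))"
          using y(1)[of n] unfolding y(2) by (simp add: divide_simps)
        also have "\<bar>\<dots>\<bar> = 1 / (y n * (y n + 1))" using y(1)[of n] by (simp add: abs_mult)
        finally have "\<bar>T (Suc n) * (g (Suc n) - g n)\<bar> \<le> T (Suc n) * (B * (1 / (y n * (y n + 1))))"
          unfolding abs_mult by (intro mult_mono) (auto simp: T_def)
        also have "\<dots> = (real n + 1) / y n * (1 / (y n + 1) ^ 3) * B"
          unfolding T_def y(2) by (simp add: power2_eq_square power3_eq_cube add_ac)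
        also have "\<dots> \<le> 1 * (1 / (real n + 2) ^ 3) * B"
          using x B by (intro mult_mono mult_right_mono divide_left_mono power_mono) (auto simp: y_def)
        finally show ?thesis by simp
      qed
      hence "\<bar>\<Sum>n<m. T (Suc n) * (g (Suc n) - g n)\<bar> \<le> (\<Sum>n<m. 1 / (real n + 2) ^ 3 * B)"
        by (intro order_trans[OF sum_abs] sum_mono)
      also have "\<dots> \<le> 1 / 4 * B"
        unfolding sum_distrib_right[symmetric] by (intro mult_right_mono cubes_sum B)
      finally show ?thesis .
    qed
    moreover have "\<bar>\<Sum>n<m. w n * g' n\<bar> \<le> 5 / 8 * B"
    proof -
      have "\<bar>w n * g' n\<bar> \<le> w n * B" for n
      proof -
        have "0 \<le> w n" using x y(1)[of n] by (simp add: w_def)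
        thus ?thesis
          unfolding abs_mult g'_def B_def using le_sup01[OF gauss_deriv_continuous V[of n]]
          by (intro mult_mono) auto
      qed
      hence "\<bar>\<Sum>n<m. w n * g' n\<bar> \<le> (\<Sum>n<m. w n * B)"
        by (intro order_trans[OF sum_abs] sum_mono)
      also have "\<dots> \<le> 5 / 8 * B"
        unfolding sum_distrib_right[symmetric] w_def y_def by (intro mult_right_mono branch_weights x B)
      finally show ?thesis .
    qed
    ultimately show ?thesis by linarith
  qed
  have "(\<lambda>n. \<bar>\<Sum>i<n. t i\<bar>) \<longlonglongrightarrow> \<bar>gauss_deriv (L0 f) x\<bar>"
    using sums unfolding sums_def by (rule tendsto_rabs)
  moreover have "(\<lambda>n. 2 * c * (1 / (real n + 1)) + 7 / 8 * B) \<longlonglongrightarrow> 2 * c * 0 + 7 / 8 * B"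
    using LIMSEQ_inverse_real_of_nat by (intro tendsto_intros) (simp add: inverse_eq_divide add_ac)
  ultimately have "\<bar>gauss_deriv (L0 f) x\<bar> \<le> 2 * c * 0 + 7 / 8 * B"
    by (rule LIMSEQ_le) (use part in auto)
  thus "\<bar>gauss_deriv (L0 f) x\<bar> \<le> 7 / 8 * sup01 (gauss_deriv f)" by (simp add: B_def)
qed

text \<open>A function of zero average has a zero, so that the derivative of \<open>(1 + x) f(x)\<close> controls \<open>f\<close>.\<close>

lemma C_norm_le_gauss_deriv:
  assumes "integral {0..1} f = 0"
  shows "C_norm 1 f \<le> 3 * sup01 (gauss_deriv f)"
proof -
  define B where "B = sup01 (gauss_deriv f)"
  \<comment> \<open>The mean value theorem for the antiderivative of \<open>f\<close>, which vanishes at both end points.\<close>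
  have "\<exists>z\<in>{0<..<1}. integral {0..1} f - integral {0..0} f = f z * (1 - 0)"
    using integral_has_real_derivative[OF C_space_continuous0[OF f]]
    by (intro mvt_simple) (auto simp: has_field_derivative_def)
  then obtain z where "z \<in> {0<..<1}" "f z = 0" using assms by auto
  hence z: "z \<in> {0..1}" "f z = 0" by auto
  have 0: "\<bar>(1 + x) * f x\<bar> \<le> B" if "x \<in> {0..1}" for x
  proof -
    have "\<bar>(1 + x) * f x\<bar> \<le> B * \<bar>x - z\<bar>"
      using gauss_deriv_lipschitz[OF that z(1)] z(2) by (simp add: B_def)
    also have "\<dots> \<le> B * 1"
      using that z sup01_nonneg[OF gauss_deriv_continuous] by (intro mult_left_mono) (auto simp: B_def)
    finally show ?thesis by simp
  qed
  have ge: "\<bar>a\<bar> \<le> \<bar>(1 + x) * a\<bar>" if "x \<in> {0..1}" for x a :: real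
    using that by (simp add: abs_mult mult_le_cancel_right1)
  have f0: "\<bar>f x\<bar> \<le> B" if "x \<in> {0..1}" for x using 0[OF that] ge[OF that] by (rule order_trans[rotated])
  have f1: "\<bar>D01 f x\<bar> \<le> 2 * B" if x: "x \<in> {0..1}" for x
  proof -
    have "\<bar>D01 f x\<bar> \<le> \<bar>(1 + x) * D01 f x\<bar>" by (rule ge[OF x])
    also have "(1 + x) * D01 f x = gauss_deriv f x - f x" by (simp add: gauss_deriv_def)
    also have "\<bar>\<dots>\<bar> \<le> B + B"
      using le_sup01[OF gauss_deriv_continuous x] f0[OF x]
      by (intro order_trans[OF abs_triangle_ineq4] add_mono) (auto simp: B_def)
    finally show ?thesis by simp
  qed
  have "C_norm 1 f = sup01 f + sup01 (D01 f)" by (simp add: C_norm_sup01)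
  also have "\<dots> \<le> B + 2 * B" by (intro add_mono sup01_le f0 f1)
  finally show ?thesis by (simp add: B_def)
qed

lemma gauss_deriv_le_C_norm: "sup01 (gauss_deriv f) \<le> 3 * C_norm 1 f"
proof (rule sup01_le)
  fix x :: real assume x: "x \<in> {0..1}"
  have "\<bar>gauss_deriv f x\<bar> \<le> \<bar>f x\<bar> + (1 + x) * \<bar>D01 f x\<bar>"
    unfolding gauss_deriv_def using x by (intro order_trans[OF abs_triangle_ineq]) (simp add: abs_mult)
  also have "\<dots> \<le> C_norm 1 f + 2 * C_norm 1 f"
    using x le_C_norm[OF f, of 0 x] le_C_norm[OF f, of 1 x] by (intro add_mono mult_mono) auto
  finally show "\<bar>gauss_deriv f x\<bar> \<le> 3 * C_norm 1 f" by simp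
qed

end

definition weighted_top :: "nat \<Rightarrow> (real \<Rightarrow> real) \<Rightarrow> real" where
  "weighted_top l f = sup01 (\<lambda>x. (1 + x) * (D01 ^^ l) f x)"

lemma top_continuous:
  "f \<in> C_space l \<Longrightarrow> continuous_on {0..1} (\<lambda>x. (1 + x) * (D01 ^^ l) f x)"
  using C_space_continuous[of f l l] by (intro continuous_intros) auto

text \<open>The leading term of the derivative of order \<open>l + 1\<close> of \<open>L0 f\<close> is contracted in the weight \<open>1 + x\<close>; this is
  an inequality of Lasota-Yorke type.\<close>

lemma weighted_top_L0:
  "\<exists>K\<ge>0. \<forall>f\<in>C_space (Suc l).
     weighted_top (Suc l) (L0 f) \<le> 5 / 8 * weighted_top (Suc l) f + K * C_norm l f"
proof (intro exI conjI ballI)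
  have z: "0 \<le> zeta2" unfolding zeta2_def by (intro suminf_nonneg summable_zeta2) auto
  define j where "j = Suc l"
  define K where "K = 2 * (\<Sum>i\<le>l. leibniz j i * zeta2)"
  show "0 \<le> K" using z by (auto simp: K_def intro!: sum_nonneg mult_nonneg_nonneg leibniz_nonneg)
  fix f assume "f \<in> C_space (Suc l)"
  hence f: "f \<in> C_space j" and fl: "f \<in> C_space l" by (auto simp: j_def intro: C_space_mono)
  define A where "A = weighted_top j f"
  have A: "0 \<le> A" unfolding A_def weighted_top_def by (intro sup01_nonneg top_continuous f)
  have "weighted_top j (L0 f) \<le> 5 / 8 * A + K * C_norm l f"
    unfolding weighted_top_def
  proof (rule sup01_le)
    fix x :: real assume x: "x \<in> {0..1}"
    let ?d = "(D01 ^^ j) f"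
    have lead: "(1 + x) * \<bar>branch_sum (2 + j + j) ?d x\<bar> \<le> 5 / 8 * A"
    proof -
      obtain c where c: "\<And>y. y \<in> {0..1} \<Longrightarrow> \<bar>?d y\<bar> \<le> c"
        using continuous_bounded01[OF C_space_continuous[OF f order_refl]] by blast
      have "(\<lambda>n. (1 + x) * (?d (1 / (real n + 1 + x)) / (real n + 1 + x) ^ (2 + j + j))) sums
          ((1 + x) * branch_sum (2 + j + j) ?d x)"
        unfolding branch_sum_def
        by (intro sums_mult summable_sums branch_sum_summable(2)[where c = c, OF _ c x]) auto
      hence "(\<lambda>m. \<bar>\<Sum>n<m. (1 + x) * (?d (1 / (real n + 1 + x)) / (real n + 1 + x) ^ (2 + j + j))\<bar>)
          \<longlonglongrightarrow> \<bar>(1 + x) * branch_sum (2 + j + j) ?d x\<bar>"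
        unfolding sums_def by (rule tendsto_rabs)
      moreover have "\<bar>\<Sum>n<m. (1 + x) * (?d (1 / (real n + 1 + x)) / (real n + 1 + x) ^ (2 + j + j))\<bar>
          \<le> 5 / 8 * A" for m
      proof -
        have "\<bar>(1 + x) * (?d (1 / (real n + 1 + x)) / (real n + 1 + x) ^ (2 + j + j))\<bar>
            \<le> (1 + x) / ((real n + 1 + x) ^ 3 * (real n + 1 + x + 1)) * A" for n
        proof -
          define y where "y = real n + 1 + x"
          have y: "1 \<le> y" using x by (simp add: y_def)
          have "\<bar>(1 + 1 / y) * ?d (1 / y)\<bar> \<le> A"
            unfolding A_def weighted_top_def y_def by (rule le_sup01[OF top_continuous[OF f] branch_in[OF x]])
          hence "\<bar>?d (1 / y)\<bar> \<le> A / (1 + 1 / y)" using y by (simp add: abs_mult field_simps)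
          also have "\<dots> = A * y / (y + 1)" using y by (simp add: divide_simps)
          finally have d: "\<bar>?d (1 / y)\<bar> \<le> A * y / (y + 1)" .
          have pow: "y ^ 4 \<le> y ^ (2 + j + j)" using y by (intro power_increasing) (auto simp: j_def)
          have "\<bar>(1 + x) * (?d (1 / y) / y ^ (2 + j + j))\<bar> = (1 + x) * (\<bar>?d (1 / y)\<bar> / y ^ (2 + j + j))"
            using x y by (simp add: abs_mult)
          also have "\<dots> \<le> (1 + x) * ((A * y / (y + 1)) / y ^ 4)"
            using x y d pow A by (intro mult_left_mono frac_le) auto
          also have "\<dots> = (1 + x) / (y ^ 3 * (y + 1)) * A"
            using y by (simp add: divide_simps power3_eq_cube power4_eq_xxxx)
          finally show ?thesis unfolding y_def .
        qed
        hence "\<bar>\<Sum>n<m. (1 + x) * (?d (1 / (real n + 1 + x)) / (real n + 1 + x) ^ (2 + j + j))\<bar>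
            \<le> (\<Sum>n<m. (1 + x) / ((real n + 1 + x) ^ 3 * (real n + 1 + x + 1)) * A)"
          by (intro order_trans[OF sum_abs] sum_mono)
        also have "\<dots> \<le> 5 / 8 * A"
          unfolding sum_distrib_right[symmetric] by (intro mult_right_mono branch_weights x A)
        finally show ?thesis .
      qed
      ultimately have "\<bar>(1 + x) * branch_sum (2 + j + j) ?d x\<bar> \<le> 5 / 8 * A"
        by (intro LIMSEQ_le_const2) auto
      thus ?thesis using x by (simp add: abs_mult)
    qed
    have low: "\<bar>\<Sum>i\<le>l. leibniz j i * branch_sum (2 + j + i) ((D01 ^^ i) f) x\<bar>
        \<le> (\<Sum>i\<le>l. leibniz j i * zeta2) * C_norm l f"
    proof -
      have "\<bar>leibniz j i * branch_sum (2 + j + i) ((D01 ^^ i) f) x\<bar>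
          \<le> leibniz j i * zeta2 * C_norm l f" if "i \<le> l" for i
        unfolding abs_mult mult.assoc
        by (intro mult_mono branch_sum_bound[OF _ _ x] le_C_norm[OF fl that])
           (auto simp: leibniz_nonneg)
      thus ?thesis unfolding sum_distrib_right
        by (intro order_trans[OF sum_abs] sum_mono) auto
    qed
    have "(D01 ^^ j) (L0 f) x = (- 1) ^ j * ((\<Sum>i\<le>l. leibniz j i * branch_sum (2 + j + i) ((D01 ^^ i) f) x)
        + branch_sum (2 + j + j) ?d x)"
      using D01_L0[OF f order_refl x] unfolding branch_jet_def
      by (simp add: j_def leibniz_diag del: leibniz.simps)
    hence "\<bar>(1 + x) * (D01 ^^ j) (L0 f) x\<bar>
        = (1 + x) * \<bar>(\<Sum>i\<le>l. leibniz j i * branch_sum (2 + j + i) ((D01 ^^ i) f) x)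
            + branch_sum (2 + j + j) ?d x\<bar>"
      using x by (simp add: abs_mult)
    also have "\<dots> \<le> (1 + x) * (\<bar>\<Sum>i\<le>l. leibniz j i * branch_sum (2 + j + i) ((D01 ^^ i) f) x\<bar>
            + \<bar>branch_sum (2 + j + j) ?d x\<bar>)"
      using x by (intro mult_left_mono abs_triangle_ineq) auto
    also have "\<dots> \<le> 2 * ((\<Sum>i\<le>l. leibniz j i * zeta2) * C_norm l f) + 5 / 8 * A"
      unfolding distrib_left using x by (intro add_mono lead mult_mono low) auto
    finally show "\<bar>(1 + x) * (D01 ^^ j) (L0 f) x\<bar> \<le> 5 / 8 * A + K * C_norm l f"
      by (simp add: K_def)
  qed
  thus "weighted_top (Suc l) (L0 f) \<le> 5 / 8 * weighted_top (Suc l) f + K * C_norm l f"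
    by (simp add: A_def j_def)
qed

text \<open>A norm in which one application of \<open>L0\<close> already contracts.  The constants are
  existentially quantified, so that the norm can be built by adding one derivative at a time.\<close>

definition adapted_norm :: "nat \<Rightarrow> ((real \<Rightarrow> real) \<Rightarrow> real) \<Rightarrow> real \<Rightarrow> bool" where
  "adapted_norm l N q \<longleftrightarrow> 0 \<le> q \<and> q < 1 \<and>
     (\<forall>f\<in>C_space0 l. \<forall>g\<in>C_space0 l. N (f + g) \<le> N f + N g) \<and>
     (\<forall>f\<in>C_space0 l. \<forall>a. N (a *\<^sub>R f) = \<bar>a\<bar> * N f) \<and>
     (\<exists>c>0. \<forall>f\<in>C_space0 l. c * C_norm l f \<le> N f) \<and>
     (\<exists>C>0. \<forall>f\<in>C_space0 l. N f \<le> C * C_norm l f) \<and>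
     (\<forall>f\<in>C_space0 l. N (L0 f) \<le> q * N f)"

lemma adapted_norm_1: "adapted_norm 1 (\<lambda>f. sup01 (gauss_deriv f)) (7 / 8)"
  unfolding adapted_norm_def
proof (intro conjI ballI allI)
  fix f g assume "f \<in> C_space0 1" "g \<in> C_space0 1"
  hence f: "f \<in> C_space 1" and g: "g \<in> C_space 1" by (auto simp: C_space0_def)
  have "sup01 (gauss_deriv (f + g)) = sup01 (\<lambda>x. gauss_deriv f x + gauss_deriv g x)"
    using D01_add[OF f g, of 1] by (intro sup01_cong) (simp add: gauss_deriv_def algebra_simps)
  also have "\<dots> \<le> sup01 (gauss_deriv f) + sup01 (gauss_deriv g)"
    by (intro sup01_add gauss_deriv_continuous f g)
  finally show "sup01 (gauss_deriv (f + g)) \<le> sup01 (gauss_deriv f) + sup01 (gauss_deriv g)" .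
next
  fix f a assume "f \<in> C_space0 1"
  hence f: "f \<in> C_space 1" by (auto simp: C_space0_def)
  have "sup01 (gauss_deriv (a *\<^sub>R f)) = sup01 (\<lambda>x. a * gauss_deriv f x)"
    using D01_scale[OF f, of 1] by (intro sup01_cong) (simp add: gauss_deriv_def algebra_simps)
  also have "\<dots> = \<bar>a\<bar> * sup01 (gauss_deriv f)" by (intro sup01_scale gauss_deriv_continuous f)
  finally show "sup01 (gauss_deriv (a *\<^sub>R f)) = \<bar>a\<bar> * sup01 (gauss_deriv f)" .
next
  show "\<exists>c>0. \<forall>f\<in>C_space0 1. c * C_norm 1 f \<le> sup01 (gauss_deriv f)"
  proof (intro exI conjI ballI)
    fix f assume "f \<in> C_space0 1"
    hence "C_norm 1 f \<le> 3 * sup01 (gauss_deriv f)"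
      by (intro C_norm_le_gauss_deriv) (auto simp: C_space0_def)
    thus "1 / 3 * C_norm 1 f \<le> sup01 (gauss_deriv f)" by linarith
  qed simp
  show "\<exists>C>0. \<forall>f\<in>C_space0 1. sup01 (gauss_deriv f) \<le> C * C_norm 1 f"
    using gauss_deriv_le_C_norm by (intro exI[of _ 3]) (auto simp: C_space0_def)
next
  fix f assume "f \<in> C_space0 1"
  thus "sup01 (gauss_deriv (L0 f)) \<le> 7 / 8 * sup01 (gauss_deriv f)"
    by (intro gauss_deriv_contraction) (auto simp: C_space0_def)
qed auto

lemma C_norm_Suc: "C_norm (Suc l) f = C_norm l f + sup01 ((D01 ^^ Suc l) f)"
  by (simp add: C_norm_sup01)

lemma weighted_top_bounds:
  assumes f: "f \<in> C_space l"
  shows "sup01 ((D01 ^^ l) f) \<le> weighted_top l f" "weighted_top l f \<le> 2 * sup01 ((D01 ^^ l) f)"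
proof -
  show "sup01 ((D01 ^^ l) f) \<le> weighted_top l f"
  proof (rule sup01_le)
    fix x :: real assume x: "x \<in> {0..1}"
    have "\<bar>(D01 ^^ l) f x\<bar> \<le> \<bar>(1 + x) * (D01 ^^ l) f x\<bar>"
      using x by (simp add: abs_mult mult_le_cancel_right1)
    also have "\<dots> \<le> weighted_top l f"
      unfolding weighted_top_def by (rule le_sup01[OF top_continuous[OF f] x])
    finally show "\<bar>(D01 ^^ l) f x\<bar> \<le> weighted_top l f" .
  qed
  show "weighted_top l f \<le> 2 * sup01 ((D01 ^^ l) f)"
    unfolding weighted_top_def
  proof (rule sup01_le)
    fix x :: real assume x: "x \<in> {0..1}"
    show "\<bar>(1 + x) * (D01 ^^ l) f x\<bar> \<le> 2 * sup01 ((D01 ^^ l) f)"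
      unfolding abs_mult using x le_sup01[OF C_space_continuous[OF f] x, of l] by (intro mult_mono) auto
  qed
qed

lemma adapted_norm_Suc:
  assumes "adapted_norm l N q"
  shows "\<exists>N' q'. adapted_norm (Suc l) N' q'"
proof -
  have sub: "f \<in> C_space0 l" "f \<in> C_space (Suc l)" "f \<in> C_space l" if "f \<in> C_space0 (Suc l)" for f
    using that C_space_mono[of f "Suc l" l] by (auto simp: C_space0_def)
  have q: "0 \<le> q" "q < 1"
    and add: "\<And>f g. f \<in> C_space0 l \<Longrightarrow> g \<in> C_space0 l \<Longrightarrow> N (f + g) \<le> N f + N g"
    and scale: "\<And>f a. f \<in> C_space0 l \<Longrightarrow> N (a *\<^sub>R f) = \<bar>a\<bar> * N f"
    and contr: "\<And>f. f \<in> C_space0 l \<Longrightarrow> N (L0 f) \<le> q * N f"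
    using assms by (auto simp: adapted_norm_def)
  obtain c where c: "0 < c" "\<And>f. f \<in> C_space0 l \<Longrightarrow> c * C_norm l f \<le> N f"
    using assms by (auto simp: adapted_norm_def)
  obtain C where C: "0 < C" "\<And>f. f \<in> C_space0 l \<Longrightarrow> N f \<le> C * C_norm l f"
    using assms by (auto simp: adapted_norm_def)
  obtain K where K: "0 \<le> K" "\<And>f. f \<in> C_space (Suc l) \<Longrightarrow>
     weighted_top (Suc l) (L0 f) \<le> 5 / 8 * weighted_top (Suc l) f + K * C_norm l f"
    using weighted_top_L0[of l] by blast
  \<comment> \<open>The weight of the top derivative is so small that the lower-order terms do not destroy the
    contraction of \<open>N\<close>.\<close>
  define \<delta> where "\<delta> = (1 - q) / 2 / (K / c + 1)"
  have Kc: "0 \<le> K / c" using K c by auto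
  have \<delta>: "0 < \<delta>" using q Kc by (simp add: \<delta>_def)
  have "\<delta> * (K / c) \<le> \<delta> * (K / c + 1)" using \<delta> by (intro mult_left_mono) auto
  also have "\<dots> = (1 - q) / 2"
    using Kc unfolding \<delta>_def by (subst times_divide_eq_left, subst nonzero_mult_div_cancel_right) auto
  finally have \<delta>K: "q + \<delta> * (K / c) \<le> (1 + q) / 2" by (simp add: field_simps)
  define q' where "q' = max (5 / 8) ((1 + q) / 2)"
  define N' where "N' f = N f + \<delta> * weighted_top (Suc l) f" for f
  have N0: "0 \<le> N f" if "f \<in> C_space0 (Suc l)" for f
    using c(2)[of f] c(1) C_norm_nonneg[of f l] sub[OF that]
    by (meson less_imp_le mult_nonneg_nonneg order_trans)
  have W0: "0 \<le> weighted_top (Suc l) f" if "f \<in> C_space0 (Suc l)" for f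
    using sub(2)[OF that] unfolding weighted_top_def by (intro sup01_nonneg top_continuous)
  have "adapted_norm (Suc l) N' q'"
    unfolding adapted_norm_def
  proof (intro conjI ballI allI)
    show "0 \<le> q'" "q' < 1" using q by (auto simp: q'_def)
  next
    fix f g assume fg: "f \<in> C_space0 (Suc l)" "g \<in> C_space0 (Suc l)"
    note f = sub[OF fg(1)] and g = sub[OF fg(2)]
    have "weighted_top (Suc l) (f + g)
        = sup01 (\<lambda>x. (1 + x) * (D01 ^^ Suc l) f x + (1 + x) * (D01 ^^ Suc l) g x)"
      unfolding weighted_top_def
      using D01_add[OF f(2) g(2) order_refl] by (intro sup01_cong) (simp only: distrib_left)
    also have "\<dots> \<le> weighted_top (Suc l) f + weighted_top (Suc l) g"
      unfolding weighted_top_def by (intro sup01_add top_continuous f g)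
    finally have "\<delta> * weighted_top (Suc l) (f + g) \<le> \<delta> * (weighted_top (Suc l) f + weighted_top (Suc l) g)"
      using \<delta> by (intro mult_left_mono) auto
    thus "N' (f + g) \<le> N' f + N' g"
      using add[OF f(1) g(1)] by (simp add: N'_def distrib_left)
  next
    fix f a assume "f \<in> C_space0 (Suc l)"
    note f = sub[OF this]
    have "weighted_top (Suc l) (a *\<^sub>R f) = sup01 (\<lambda>x. a * ((1 + x) * (D01 ^^ Suc l) f x))"
      unfolding weighted_top_def
      using D01_scale[OF f(2) order_refl] by (intro sup01_cong) (simp only: mult.left_commute)
    also have "\<dots> = \<bar>a\<bar> * weighted_top (Suc l) f"
      unfolding weighted_top_def by (intro sup01_scale top_continuous f)
    finally show "N' (a *\<^sub>R f) = \<bar>a\<bar> * N' f"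
      using scale[OF f(1), of a] by (simp add: N'_def distrib_left mult.left_commute)
  next
    show "\<exists>c>0. \<forall>f\<in>C_space0 (Suc l). c * C_norm (Suc l) f \<le> N' f"
    proof (intro exI conjI ballI)
      show "0 < min c \<delta>" using c \<delta> by simp
      fix f assume "f \<in> C_space0 (Suc l)"
      note f = sub[OF this]
      have "min c \<delta> * C_norm l f \<le> c * C_norm l f"
        by (intro mult_right_mono C_norm_nonneg f) auto
      moreover have "min c \<delta> * sup01 ((D01 ^^ Suc l) f) \<le> \<delta> * weighted_top (Suc l) f"
        using \<delta> weighted_top_bounds[OF f(2)] sup01_nonneg[OF C_space_continuous[OF f(2)], of "Suc l"]
        by (intro mult_mono) auto
      ultimately show "min c \<delta> * C_norm (Suc l) f \<le> N' f"
        using c(2)[OF f(1)] unfolding C_norm_Suc N'_def distrib_left by linarith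
    qed
  next
    show "\<exists>C>0. \<forall>f\<in>C_space0 (Suc l). N' f \<le> C * C_norm (Suc l) f"
    proof (intro exI conjI ballI)
      show "0 < C + 2 * \<delta>" using C \<delta> by simp
      fix f assume "f \<in> C_space0 (Suc l)"
      note f = sub[OF this]
      have D0: "0 \<le> sup01 ((D01 ^^ Suc l) f)" by (intro sup01_nonneg C_space_continuous[OF f(2)]) auto
      have "N' f \<le> C * C_norm l f + \<delta> * (2 * sup01 ((D01 ^^ Suc l) f))"
        unfolding N'_def using \<delta> by (intro add_mono C(2) f mult_left_mono weighted_top_bounds) auto
      also have "\<dots> \<le> (C + 2 * \<delta>) * C_norm l f + (C + 2 * \<delta>) * sup01 ((D01 ^^ Suc l) f)"
        using C \<delta> D0 C_norm_nonneg[OF f(3)] by (simp add: distrib_right)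
      finally show "N' f \<le> (C + 2 * \<delta>) * C_norm (Suc l) f"
        unfolding C_norm_Suc distrib_left .
    qed
  next
    fix f assume f0: "f \<in> C_space0 (Suc l)"
    note f = sub[OF f0]
    have "K * C_norm l f \<le> K * (N f / c)"
      using c K f by (intro mult_left_mono) (auto simp: le_divide_eq mult.commute)
    hence "weighted_top (Suc l) (L0 f) \<le> 5 / 8 * weighted_top (Suc l) f + (K / c) * N f"
      using K(2)[OF f(2)] by simp
    hence "\<delta> * weighted_top (Suc l) (L0 f) \<le> \<delta> * (5 / 8 * weighted_top (Suc l) f + (K / c) * N f)"
      using \<delta> by (intro mult_left_mono) auto
    hence "N' (L0 f) \<le> q * N f + \<delta> * (5 / 8 * weighted_top (Suc l) f + (K / c) * N f)"
      unfolding N'_def using contr[OF f(1)] by linarith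
    also have "\<dots> = (q + \<delta> * (K / c)) * N f + 5 / 8 * (\<delta> * weighted_top (Suc l) f)"
      by (simp add: algebra_simps)
    also have "\<dots> \<le> q' * N f + q' * (\<delta> * weighted_top (Suc l) f)"
    proof -
      have "q + \<delta> * (K / c) \<le> q'" "5 / 8 \<le> q'" using \<delta>K by (simp_all only: q'_def max.coboundedI1 max.coboundedI2 order_refl)
      thus ?thesis using N0[OF f0] W0[OF f0] \<delta> by (intro add_mono mult_right_mono) auto
    qed
    finally show "N' (L0 f) \<le> q' * N' f" by (simp add: N'_def distrib_left)
  qed
  thus ?thesis by blast
qed

lemma adapted_norm_exists: "1 \<le> l \<Longrightarrow> \<exists>N q. adapted_norm l N q"
proof (induction l rule: dec_induct)
  case base
  show ?case using adapted_norm_1 by blast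
next
  case (step l)
  then obtain N q where "adapted_norm l N q" by blast
  thus ?case by (rule adapted_norm_Suc)
qed

section \<open>The Gauss density\<close>

definition gauss_density :: "real \<Rightarrow> real" where
  "gauss_density x = (if x \<in> {0..1} then 1 / (ln 2 * (1 + x)) else 0)"

lemma gauss_density_C_space: "gauss_density \<in> C_space l"
proof (rule C_spaceI)
  define F where "F j x = (- 1) ^ j * fact j * inverse (ln 2) * inverse (1 + x) ^ Suc j" for j and x :: real
  show "jet l F"
  proof (rule jetI)
    fix j x assume x: "x \<in> {0..1::real}"
    have inv: "((\<lambda>x. inverse (1 + x)) has_real_derivative - (inverse (1 + x))\<^sup>2) (at x within {0..1})"
      using x by (auto intro!: derivative_eq_intros simp: power2_eq_square)
    have "((\<lambda>x. inverse (1 + x) ^ Suc j) has_real_derivative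
        - real (Suc j) * inverse (1 + x) ^ Suc (Suc j)) (at x within {0..1})"
      by (rule DERIV_cong[OF DERIV_power[OF inv]]) (simp add: power2_eq_square algebra_simps)
    from DERIV_cmult[OF this, of "(- 1) ^ j * fact j * inverse (ln 2)"]
    show "(F j has_real_derivative F (Suc j) x) (at x within {0..1})"
      by (simp add: F_def[abs_def] algebra_simps)
  next
    show "continuous_on {0..1} (F l)" unfolding F_def[abs_def] by (intro continuous_intros) auto
  qed
  show "gauss_density x = F 0 x" if "x \<in> {0..1}" for x
    using that by (simp add: F_def gauss_density_def field_simps)
qed (auto simp: gauss_density_def)

lemma gauss_density_integral: "integral {0..1} gauss_density = 1"
proof -
  have "(gauss_density has_integral ln (1 + 1) / ln 2 - ln (1 + 0) / ln 2) {0..1}"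
    by (rule fundamental_theorem_of_calculus)
       (auto intro!: derivative_eq_intros simp: gauss_density_def
          simp flip: has_real_derivative_iff_has_vector_derivative)
  thus ?thesis by (auto dest: integral_unique)
qed

lemma gauss_density_ge: "x \<in> {0..1} \<Longrightarrow> 1 / (2 * ln 2) \<le> gauss_density x"
  unfolding gauss_density_def by (auto intro!: divide_left_mono mult_pos_pos simp: mult.commute)

lemma L0_gauss_density: "L0 gauss_density = gauss_density"
proof
  fix x
  show "L0 gauss_density x = gauss_density x"
  proof (cases "x \<in> {0..1}")
    case x: True
    have tele: "gauss_density (1 / (real n + 1 + x)) / (real n + 1 + x) ^ 2
        = 1 / ln 2 / (real n + 1 + x) - 1 / ln 2 / (real (Suc n) + 1 + x)" for n
    proof -
      define y where "y = real n + 1 + x"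
      have y: "1 \<le> y" using x by (simp add: y_def)
      have eq: "real (Suc n) + 1 + x = y + 1" by (simp add: y_def)
      have "gauss_density (1 / y) = 1 / (ln 2 * (1 + 1 / y))"
        using branch_in[OF x, of n] by (simp add: gauss_density_def y_def)
      also have "\<dots> = y / (ln 2 * (y + 1))" using y by (simp add: field_simps)
      finally show ?thesis unfolding eq y_def[symmetric]
        using y by (simp add: divide_simps power2_eq_square)
    qed
    have "(\<lambda>n. 1 / ln 2 / (real n + 1 + x)) \<longlonglongrightarrow> 0"
    proof (rule Lim_null_comparison)
      show "(\<lambda>n. 1 / ln 2 * (1 / (real n + 1))) \<longlonglongrightarrow> 0"
        using tendsto_mult_right_zero[OF LIMSEQ_inverse_real_of_nat, of "1 / ln 2"]
        by (simp add: inverse_eq_divide add_ac)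
      have "norm (1 / ln 2 / (real n + 1 + x)) \<le> 1 / ln 2 * (1 / (real n + 1))" for n
        using x by (auto intro!: divide_left_mono mult_pos_pos mult_left_mono)
      thus "\<forall>\<^sub>F n in sequentially. norm (1 / ln 2 / (real n + 1 + x)) \<le> 1 / ln 2 * (1 / (real n + 1))"
        by (intro always_eventually allI)
    qed
    from telescope_sums'[OF this]
    have "(\<lambda>n. gauss_density (1 / (real n + 1 + x)) / (real n + 1 + x) ^ 2) sums (1 / ln 2 / (1 + x))"
      unfolding tele by simp
    thus ?thesis
      using L0_eq[OF x C_space_continuous0[OF gauss_density_C_space]] x
      by (simp add: branch_sum_def sums_iff gauss_density_def)
  next
    case False
    thus ?thesis using L0_outside by (simp add: gauss_density_def)
  qed
qed

text \<open>The derivative of \<open>annealed \<epsilon> gauss_density\<close> with respect to \<open>\<epsilon>\<close>; this is the vector to which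
  the resolvent is applied in the expansion.\<close>

definition gauss_drift :: "real \<Rightarrow> real" where
  "gauss_drift = L1 gauss_density - gauss_density"

lemma gauss_drift_C_space0: "gauss_drift \<in> C_space0 l"
proof -
  note h = gauss_density_C_space[of l]
  note c = C_space_continuous0[OF L1_in_C_space[OF h]] C_space_continuous0[OF h]
  have "integral {0..1} (\<lambda>x. L1 gauss_density x - gauss_density x) = 0"
    by (subst integral_diff) (auto intro!: integrable_continuous_real c simp: L1_integral[OF c(2)])
  thus ?thesis
    using C_space_diff[OF L1_in_C_space[OF h] h] by (simp add: C_space0_def gauss_drift_def fun_diff_def)
qed

section \<open>The Gauss-Renyi family as a perturbed contraction\<close>

lemma gauss_renyi_perturbed_contraction:
  assumes "1 \<le> l"
  shows "\<exists>N q K c. perturbed_contraction (C_space0 l) N L0 L1 q K \<and> 0 < c \<and>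
    (\<forall>f\<in>C_space0 l. C_norm l f \<le> c * N f)"
proof -
  obtain N q where N: "adapted_norm l N q" using adapted_norm_exists[OF assms] by blast
  obtain c where c: "0 < c" "\<And>f. f \<in> C_space0 l \<Longrightarrow> c * C_norm l f \<le> N f"
    using N by (auto simp: adapted_norm_def)
  obtain C where C: "0 < C" "\<And>f. f \<in> C_space0 l \<Longrightarrow> N f \<le> C * C_norm l f"
    using N by (auto simp: adapted_norm_def)
  have c': "C_norm l f \<le> (1 / c) * N f" if "f \<in> C_space0 l" for f
    using c(2)[OF that] c(1) by (simp add: field_simps)
  have S: "f \<in> C_space l" "continuous_on {0..1} f" if "f \<in> C_space0 l" for f
    using that C_space_continuous0 by (auto simp: C_space0_def)
  have "perturbed_contraction (C_space0 l) N L0 L1 q (q * (C * (1 / c)))"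
  proof
    show "subspace (C_space0 l)" by (rule subspace_C_space0)
  next
    fix f assume f: "f \<in> C_space0 l" "N f = 0"
    hence "C_norm l f = 0" using c'[OF f(1)] C_norm_nonneg[OF S(1)[OF f(1)]] by simp
    thus "f = 0" by (rule C_norm_eq_0[OF S(1)[OF f(1)]])
  next
    fix u :: "nat \<Rightarrow> real \<Rightarrow> real" assume u: "\<And>n. u n \<in> C_space0 l" and sm: "summable (\<lambda>n. N (u n))"
    have "summable (\<lambda>n. C_norm l (u n))"
      by (rule summable_comparison_test'[OF summable_mult[OF sm, of "1 / c"]])
         (use c'[OF u] C_norm_nonneg[OF S(1)[OF u]] in auto)
    from C_space0_complete[OF u this] obtain s where
      s: "s \<in> C_space0 l" "(\<lambda>n. C_norm l (s - (\<Sum>i<n. u i))) \<longlonglongrightarrow> 0" by blast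
    have d: "s - (\<Sum>i<n. u i) \<in> C_space0 l" for n
      by (intro subspace_diff[OF subspace_C_space0] subspace_sum[OF subspace_C_space0] u s)
    have "0 \<le> N (s - (\<Sum>i<n. u i))" for n
      using c(2)[OF d[of n]] c(1) C_norm_nonneg[OF S(1)[OF d[of n]]]
      by (meson less_imp_le mult_nonneg_nonneg order_trans)
    hence 1: "\<forall>\<^sub>F n in sequentially. 0 \<le> N (s - (\<Sum>i<n. u i))" by (intro always_eventually allI)
    have 2: "\<forall>\<^sub>F n in sequentially. N (s - (\<Sum>i<n. u i)) \<le> C * C_norm l (s - (\<Sum>i<n. u i))"
      using C(2)[OF d] by (intro always_eventually allI)
    have 3: "(\<lambda>n. C * C_norm l (s - (\<Sum>i<n. u i))) \<longlonglongrightarrow> 0"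
      by (rule tendsto_mult_right_zero[OF s(2)])
    have "(\<lambda>n. N (s - (\<Sum>i<n. u i))) \<longlonglongrightarrow> 0"
      by (rule tendsto_sandwich[OF 1 2 tendsto_const 3])
    thus "\<exists>s\<in>C_space0 l. (\<lambda>n. N (s - (\<Sum>i<n. u i))) \<longlonglongrightarrow> 0" using s(1) by (rule bexI)
  next
    fix f assume f: "f \<in> C_space0 l"
    have r: "reflect f \<in> C_space0 l"
      using reflect_C_space(1)[OF S(1)[OF f]] reflect_integral[OF S(2)[OF f]] f
      by (simp add: C_space0_def)
    have "N (L1 f) \<le> q * N (reflect f)"
      using N r by (simp add: L1_eq[OF S(2)[OF f]] adapted_norm_def)
    also have "N (reflect f) \<le> C * C_norm l f"
      using C(2)[OF r] reflect_C_space(2)[OF S(1)[OF f]] C(1) by (meson less_imp_le mult_left_mono order_trans)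
    also have "C_norm l f \<le> (1 / c) * N f" by (rule c'[OF f])
    finally show "N (L1 f) \<le> q * (C * (1 / c)) * N f"
      using N C(1) by (simp add: adapted_norm_def mult_left_mono mult.assoc)
  next
    fix f g assume fg: "f \<in> C_space0 l" "g \<in> C_space0 l"
    show "L0 (f + g) = L0 f + L0 g" "L1 (f + g) = L1 f + L1 g"
      using L0_lincomb[OF S(2)[OF fg(1)] S(2)[OF fg(2)], of 1 1]
        L1_lincomb[OF S(2)[OF fg(1)] S(2)[OF fg(2)], of 1 1] by (simp_all only: scaleR_one)
  next
    fix f a assume f: "f \<in> C_space0 l"
    show "L0 (a *\<^sub>R f) = a *\<^sub>R L0 f" "L1 (a *\<^sub>R f) = a *\<^sub>R L1 f"
      using L0_lincomb[OF S(2)[OF f] S(2)[OF f], of a 0]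
        L1_lincomb[OF S(2)[OF f] S(2)[OF f], of a 0] by (simp_all only: scaleR_zero_left add_0_right)
  qed (use N C c in \<open>auto simp: adapted_norm_def L0_in_C_space0 L1_in_C_space0\<close>)
  moreover have "0 < 1 / c" using c by simp
  ultimately show ?thesis using c' by blast
qed

section \<open>Derivatives of \<open>C\<^sup>l\<close>-valued maps\<close>

lemma has_C_derivative_unique:
  assumes s: "0 \<le> s" and D: "has_C_derivative l \<phi> \<psi> s" "has_C_derivative l \<phi> \<psi>' s"
  shows "\<psi> = \<psi>'"
proof -
  have in_C: "\<psi> \<in> C_space l" "\<psi>' \<in> C_space l" "\<phi> s \<in> C_space l"
    "\<forall>\<^sub>F t in at s within {0..}. \<phi> t \<in> C_space l"
    using D by (auto simp: has_C_derivative_def)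
  let ?F = "at s within {0..}"
  define E where "E \<psi> t = C_norm l (\<lambda>x. (\<phi> t x - \<phi> s x) / (t - s) - \<psi> x)" for \<psi> t
  have nontriv: "?F \<noteq> bot"
  proof -
    have "at_right s \<le> ?F" by (rule at_le) (use s in auto)
    thus ?thesis using trivial_limit_at_right_real[of s] by (metis bot_unique)
  qed
  have "\<forall>\<^sub>F t in ?F. C_norm l (\<psi> - \<psi>') \<le> E \<psi>' t + E \<psi> t"
    using in_C(4)
  proof eventually_elim
    case (elim t)
    define A where "A = (1 / (t - s)) *\<^sub>R (\<phi> t - \<phi> s)"
    have A: "A \<in> C_space l"
      unfolding A_def by (intro C_space_scale C_space_diff elim in_C)
    have E: "E \<xi> t = C_norm l (A - \<xi>)" for \<xi>
      by (simp add: E_def A_def fun_diff_def)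
    have "C_norm l (\<psi> - \<psi>') = C_norm l ((A - \<psi>') + (- 1) *\<^sub>R (A - \<psi>))" by (simp add: algebra_simps)
    also have "\<dots> \<le> C_norm l (A - \<psi>') + C_norm l ((- 1) *\<^sub>R (A - \<psi>))"
      by (intro C_norm_add C_space_scale C_space_diff A in_C)
    also have "C_norm l ((- 1) *\<^sub>R (A - \<psi>)) = C_norm l (A - \<psi>)"
      using C_norm_scale[OF C_space_diff[OF A in_C(1)], of "- 1"] by simp
    finally show ?case unfolding E .
  qed
  moreover have "((\<lambda>t. E \<psi>' t + E \<psi> t) \<longlongrightarrow> 0 + 0) ?F"
    using D unfolding has_C_derivative_def E_def by (intro tendsto_add) auto
  ultimately have "C_norm l (\<psi> - \<psi>') \<le> 0"
    using tendsto_lowerbound[OF _ _ nontriv] by fastforce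
  moreover have "\<psi> - \<psi>' \<in> C_space l" by (intro C_space_diff in_C)
  ultimately have "\<psi> - \<psi>' = 0" using C_norm_eq_0 C_norm_nonneg by (metis order_antisym)
  thus ?thesis by simp
qed

lemma C_deriv_eq: "0 \<le> s \<Longrightarrow> has_C_derivative l \<phi> \<psi> s \<Longrightarrow> C_deriv l \<phi> s = \<psi>"
  unfolding C_deriv_def by (rule the_equality) (auto intro: has_C_derivative_unique)

lemma has_C_derivativeI:
  assumes \<phi>: "\<And>t. t \<in> {0..<\<delta>} \<Longrightarrow> \<phi> t \<in> C_space l" and \<psi>: "\<psi> \<in> C_space l" and s: "s \<in> {0..<\<delta>}"
    and bound: "\<And>t. t \<in> {0..<\<delta>} \<Longrightarrow> C_norm l (\<phi> t - \<phi> s - (t - s) *\<^sub>R \<psi>) \<le> C * (t - s)\<^sup>2"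
  shows "has_C_derivative l \<phi> \<psi> s"
  unfolding has_C_derivative_def
proof (intro conjI \<psi> \<phi> s)
  have ev: "\<forall>\<^sub>F t in at s within {0..}. t \<in> {0..<\<delta>} \<and> t \<noteq> s"
    unfolding eventually_at using s by (intro exI[of _ "\<delta> - s"]) (auto simp: dist_real_def)
  show "\<forall>\<^sub>F t in at s within {0..}. \<phi> t \<in> C_space l"
    using ev by eventually_elim (use \<phi> in auto)
  have bd: "\<forall>\<^sub>F t in at s within {0..}. norm (C_norm l (\<lambda>x. (\<phi> t x - \<phi> s x) / (t - s) - \<psi> x)) \<le> C * \<bar>t - s\<bar>"
    using ev
  proof eventually_elim
    case (elim t)
    define e where "e = \<phi> t - \<phi> s - (t - s) *\<^sub>R \<psi>"
    have e: "e \<in> C_space l" unfolding e_def using elim by (intro C_space_diff C_space_scale \<phi> \<psi> s) auto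
    have "(\<lambda>x. (\<phi> t x - \<phi> s x) / (t - s) - \<psi> x) = (1 / (t - s)) *\<^sub>R e"
      using elim by (auto simp: e_def fun_eq_iff diff_divide_distrib)
    hence "norm (C_norm l (\<lambda>x. (\<phi> t x - \<phi> s x) / (t - s) - \<psi> x)) = C_norm l e / \<bar>t - s\<bar>"
      using C_norm_nonneg[OF e] by (simp add: C_norm_scale[OF e])
    also have "\<dots> \<le> C * (t - s)\<^sup>2 / \<bar>t - s\<bar>"
      using bound[of t] elim by (intro divide_right_mono) (auto simp: e_def)
    also have "\<dots> = C * \<bar>t - s\<bar>"
    proof -
      have "(t - s)\<^sup>2 = \<bar>t - s\<bar> * \<bar>t - s\<bar>" by (simp add: power2_eq_square)
      thus ?thesis using elim by (simp only: mult.assoc[symmetric]) simp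
    qed
    finally show ?case .
  qed
  have "((\<lambda>t. C * \<bar>t - s\<bar>) \<longlongrightarrow> C * \<bar>s - s\<bar>) (at s within {0..})" by (intro tendsto_intros)
  hence "((\<lambda>t. C * \<bar>t - s\<bar>) \<longlongrightarrow> 0) (at s within {0..})" by simp
  thus "((\<lambda>t. C_norm l (\<lambda>x. (\<phi> t x - \<phi> s x) / (t - s) - \<psi> x)) \<longlongrightarrow> 0) (at s within {0..})"
    by (rule Lim_null_comparison[OF bd])
qed

section \<open>The asymptotic expansion\<close>

lemma annealed_add:
  assumes "f \<in> C_space l" "g \<in> C_space l"
  shows "annealed \<epsilon> (f + g) = annealed \<epsilon> f + annealed \<epsilon> g"
  using L0_lincomb[OF C_space_continuous0[OF assms(1)] C_space_continuous0[OF assms(2)], of 1 1]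
    L1_lincomb[OF C_space_continuous0[OF assms(1)] C_space_continuous0[OF assms(2)], of 1 1]
  unfolding annealed_def scaleR_one by (simp add: fun_eq_iff algebra_simps)

lemma annealed_gauss_density: "annealed \<epsilon> gauss_density = gauss_density + \<epsilon> *\<^sub>R gauss_drift"
  by (simp add: annealed_def L0_gauss_density gauss_drift_def fun_eq_iff algebra_simps)

theorem mainTheorem2:
  fixes k l :: nat
  assumes "k \<ge> 1" and "l \<ge> 1"
  defines "h \<equiv> invariant_density l"
  defines "v \<equiv> (\<lambda>x. L1 (h 0) x - h 0 x)"
  defines "R \<equiv> (\<lambda>\<epsilon>. I_minus_L_inv l \<epsilon> v)"
  shows "v \<in> C_space0 l \<and>
    (\<exists>\<epsilon>0>0. \<forall>\<epsilon>\<in>{0..<\<epsilon>0}.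
        (\<exists>!f. is_invariant_density l \<epsilon> f) \<and>
        bij_betw (I_minus_L \<epsilon>) (C_space0 l) (C_space0 l) \<and>
        (\<forall>n<k - 1. \<exists>\<psi>. has_C_derivative l ((C_deriv l ^^ n) R) \<psi> \<epsilon>)) \<and>
    (\<lambda>\<epsilon>. C_norm l (\<lambda>x. h \<epsilon> x -
        (h 0 x + (\<Sum>n=1..k. \<epsilon> ^ n / fact (n - 1) * (C_deriv l ^^ (n - 1)) R 0 x))))
      \<in> o[at_right 0](\<lambda>\<epsilon>. \<epsilon> ^ k)"
proof -
  obtain N q K c where pc: "perturbed_contraction (C_space0 l) N L0 L1 q K" and c: "0 < c"
    and le_N: "\<And>f. f \<in> C_space0 l \<Longrightarrow> C_norm l f \<le> c * N f"
    using gauss_renyi_perturbed_contraction[OF assms(2)] by blast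
  interpret perturbed_contraction "C_space0 l" N L0 L1 q K by (rule pc)
  note v0 = gauss_drift_C_space0[of l] and h0 = gauss_density_C_space[of l]
  have S_C: "f \<in> C_space l" if "f \<in> C_space0 l" for f using that by (simp add: C_space0_def)
  have T_eq: "annealed \<epsilon> = T \<epsilon>" for \<epsilon> by (simp add: annealed_def T_def fun_eq_iff)
  have I_eq: "I_minus_L \<epsilon> = (\<lambda>f. f - T \<epsilon> f)" for \<epsilon>
    by (simp add: I_minus_L_def T_eq[symmetric] fun_eq_iff)
  have Q_eq': "I_minus_L_inv l \<epsilon> = Q \<epsilon>" for \<epsilon> by (simp add: I_minus_L_inv_def Q_def I_eq)

  define M where "M = c * (N gauss_drift / (1 - rate))"
  have M: "0 \<le> M" using c rate N_nonneg[OF v0] by (simp add: M_def)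
  \<comment> \<open>The second bound makes \<open>\<epsilon> Q \<epsilon> gauss_drift\<close> at most the minimum \<open>1 / (2 ln 2)\<close> of the Gauss
    density, so that their sum is nonnegative.\<close>
  define \<delta> where "\<delta> = min threshold (1 / (2 * ln 2) / (M + 1))"
  have \<delta>: "0 < \<delta>" "\<delta> \<le> threshold" using threshold M by (auto simp: \<delta>_def)
  have dom: "\<epsilon> \<in> {0..threshold}" if "\<epsilon> \<in> {0..<\<delta>}" for \<epsilon> using that \<delta> by auto

  \<comment> \<open>\<open>(I - L\<^sub>\<epsilon>) (f - h\<^sub>0) = L\<^sub>\<epsilon> h\<^sub>0 - h\<^sub>0 = \<epsilon> v\<close> for every invariant density \<open>f\<close>.\<close>
  have inv: "is_invariant_density l \<epsilon> f \<longleftrightarrow> f = gauss_density + \<epsilon> *\<^sub>R Q \<epsilon> gauss_drift"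
    if \<epsilon>: "\<epsilon> \<in> {0..<\<delta>}" for \<epsilon> f
  proof
    note \<epsilon>' = dom[OF \<epsilon>]
    assume f: "is_invariant_density l \<epsilon> f"
    hence fC: "f \<in> C_space l" and fi: "integral {0..1} f = 1" and fT: "annealed \<epsilon> f = f"
      by (auto simp: is_invariant_density_def)
    define g where "g = f - gauss_density"
    have gC: "g \<in> C_space l" unfolding g_def by (intro C_space_diff fC h0)
    have "integral {0..1} (\<lambda>x. f x - gauss_density x) = 0"
      by (subst integral_diff)
         (auto intro!: integrable_continuous_real C_space_continuous0 fC h0 simp: fi gauss_density_integral)
    hence g: "g \<in> C_space0 l" using gC by (simp add: C_space0_def g_def fun_diff_def)
    have "f = annealed \<epsilon> (gauss_density + g)" using fT by (simp add: g_def)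
    also have "\<dots> = gauss_density + \<epsilon> *\<^sub>R gauss_drift + T \<epsilon> g"
      using annealed_add[OF h0 gC, of \<epsilon>] by (simp only: annealed_gauss_density T_eq[of \<epsilon>, symmetric])
    finally have "g = \<epsilon> *\<^sub>R gauss_drift + T \<epsilon> g"
      unfolding g_def by (metis add.assoc add_diff_cancel_left')
    hence "g - T \<epsilon> g = \<epsilon> *\<^sub>R gauss_drift" by (metis add_diff_cancel_right')
    from Q_unique[OF \<epsilon>' g this] have "g = \<epsilon> *\<^sub>R Q \<epsilon> gauss_drift"
      by (simp only: Q_scale[OF \<epsilon>' v0])
    thus "f = gauss_density + \<epsilon> *\<^sub>R Q \<epsilon> gauss_drift" by (simp add: g_def algebra_simps)
  next
    note \<epsilon>' = dom[OF \<epsilon>]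
    define g where "g = \<epsilon> *\<^sub>R Q \<epsilon> gauss_drift"
    have g: "g \<in> C_space0 l" unfolding g_def by (intro S_rules Q_in[OF \<epsilon>'] v0)
    note gC = S_C[OF g]
    assume "f = gauss_density + \<epsilon> *\<^sub>R Q \<epsilon> gauss_drift"
    hence f: "f = gauss_density + g" by (simp add: g_def)
    have "annealed \<epsilon> f = gauss_density + \<epsilon> *\<^sub>R gauss_drift + T \<epsilon> g"
      using annealed_add[OF h0 gC, of \<epsilon>] by (simp only: f annealed_gauss_density T_eq[of \<epsilon>, symmetric])
    also have "T \<epsilon> g = \<epsilon> *\<^sub>R T \<epsilon> (Q \<epsilon> gauss_drift)"
      unfolding g_def by (rule T_scale[OF Q_in[OF \<epsilon>' v0]])
    also have "T \<epsilon> (Q \<epsilon> gauss_drift) = Q \<epsilon> gauss_drift - gauss_drift"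
      using Q_eq[OF \<epsilon>' v0] by (metis add_diff_cancel_left' diff_add_cancel)
    also have "\<epsilon> *\<^sub>R \<dots> = g - \<epsilon> *\<^sub>R gauss_drift" by (simp add: g_def scaleR_diff_right)
    also have "gauss_density + \<epsilon> *\<^sub>R gauss_drift + (g - \<epsilon> *\<^sub>R gauss_drift) = f"
      by (simp add: f fun_eq_iff)
    finally have "annealed \<epsilon> f = f" .
    moreover have "integral {0..1} f = 1"
    proof -
      have "integral {0..1} (\<lambda>x. gauss_density x + g x) = integral {0..1} gauss_density + integral {0..1} g"
        by (intro integral_add integrable_continuous_real C_space_continuous0[of _ l] h0 gC)
      thus ?thesis using g by (simp add: f C_space0_def gauss_density_integral plus_fun_def)
    qed
    moreover have "0 \<le> f x" if x: "x \<in> {0..1}" for x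
    proof -
      have "\<bar>g x\<bar> \<le> C_norm l g" using le_C_norm[OF gC, of 0 x] x by simp
      also have "\<dots> = \<epsilon> * C_norm l (Q \<epsilon> gauss_drift)"
        unfolding g_def using \<epsilon> by (simp add: C_norm_scale[OF S_C[OF Q_in[OF \<epsilon>' v0]]])
      also have "\<dots> \<le> \<epsilon> * M"
        unfolding M_def using c \<epsilon>
        by (intro order_trans[OF le_N] mult_left_mono Q_bound[OF \<epsilon>'] Q_in[OF \<epsilon>'] v0) auto
      also have "\<epsilon> * M \<le> (1 / (2 * ln 2) / (M + 1)) * (M + 1)"
        using \<epsilon> M by (intro mult_mono) (auto simp: \<delta>_def)
      also have "\<dots> = 1 / (2 * ln 2)" using M by (subst times_divide_eq_left, subst nonzero_mult_div_cancel_right) auto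
      also have "\<dots> \<le> gauss_density x" by (rule gauss_density_ge[OF x])
      finally show ?thesis using \<epsilon> by (simp add: f)
    qed
    moreover have "f \<in> C_space l" unfolding f by (intro C_space_add h0 gC)
    ultimately show "is_invariant_density l \<epsilon> f" by (simp add: is_invariant_density_def)
  qed
  have h: "h \<epsilon> = gauss_density + \<epsilon> *\<^sub>R Q \<epsilon> gauss_drift" if "\<epsilon> \<in> {0..<\<delta>}" for \<epsilon>
    unfolding h_def invariant_density_def inv[OF that] by simp
  have h_0: "h 0 = gauss_density" using h[of 0] \<delta> by simp
  have v: "v = gauss_drift" unfolding v_def h_0 gauss_drift_def by (simp add: fun_eq_iff)
  have R: "R = (\<lambda>\<epsilon>. Q \<epsilon> gauss_drift)" unfolding R_def Q_eq' v ..

  let ?W = "\<lambda>n \<epsilon>. W gauss_drift n \<epsilon>"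
  have deriv: "has_C_derivative l \<phi> (fact (Suc n) *\<^sub>R ?W (Suc n) s) s"
    if \<phi>: "\<And>t. t \<in> {0..<\<delta>} \<Longrightarrow> \<phi> t = fact n *\<^sub>R ?W n t" and s: "s \<in> {0..<\<delta>}" for \<phi> n s
  proof -
    note W = W_in[OF v0 dom]
    obtain C where C: "\<And>t. t \<in> {0..threshold} \<Longrightarrow>
        N (?W n t - ?W n s - (t - s) *\<^sub>R real (Suc n) *\<^sub>R ?W (Suc n) s) \<le> C * (t - s)\<^sup>2"
      using W_derivative[OF v0 dom[OF s]] by blast
    show ?thesis
    proof (rule has_C_derivativeI[where C = "fact n * (c * C)", OF _ _ s])
      show "\<phi> t \<in> C_space l" if "t \<in> {0..<\<delta>}" for t
        unfolding \<phi>[OF that] by (intro S_C S_rules W that)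
      show "fact (Suc n) *\<^sub>R ?W (Suc n) s \<in> C_space l" by (intro S_C S_rules W s)
      fix t assume t: "t \<in> {0..<\<delta>}"
      define e where "e = ?W n t - ?W n s - (t - s) *\<^sub>R real (Suc n) *\<^sub>R ?W (Suc n) s"
      have e: "e \<in> C_space0 l" unfolding e_def by (intro S_rules W s t)
      have "\<phi> t - \<phi> s - (t - s) *\<^sub>R fact (Suc n) *\<^sub>R ?W (Suc n) s = fact n *\<^sub>R e"
        unfolding \<phi>[OF t] \<phi>[OF s] e_def by (simp add: scaleR_diff_right fact_Suc mult_ac del: W.simps)
      hence "C_norm l (\<phi> t - \<phi> s - (t - s) *\<^sub>R fact (Suc n) *\<^sub>R ?W (Suc n) s) = fact n * C_norm l e"
        by (simp only: C_norm_scale[OF S_C[OF e]]) simp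
      also have "\<dots> \<le> fact n * (c * N e)" by (intro mult_left_mono le_N e) auto
      also have "\<dots> \<le> fact n * (c * (C * (t - s)\<^sup>2))"
        using c C[OF dom[OF t]] by (intro mult_left_mono) (auto simp: e_def)
      finally show "C_norm l (\<phi> t - \<phi> s - (t - s) *\<^sub>R fact (Suc n) *\<^sub>R ?W (Suc n) s)
          \<le> fact n * (c * C) * (t - s)\<^sup>2" by (simp add: mult_ac)
    qed
  qed
  have iter: "(C_deriv l ^^ n) R s = fact n *\<^sub>R ?W n s" if "s \<in> {0..<\<delta>}" for n s
    using that
  proof (induction n arbitrary: s)
    case 0
    show ?case by (simp add: R)
  next
    case (Suc n)
    have "has_C_derivative l ((C_deriv l ^^ n) R) (fact (Suc n) *\<^sub>R ?W (Suc n) s) s"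
      by (rule deriv[OF Suc.IH Suc.prems])
    thus ?case using Suc.prems C_deriv_eq[of s] by simp
  qed

  \<comment> \<open>\<open>h \<epsilon> - h 0 = \<epsilon> Q \<epsilon> v\<close> has a factor \<open>\<epsilon>\<close> in front of the resolvent, so it is enough to expand the
    latter to order \<open>k - 1\<close>; the remainder is then exactly \<open>\<epsilon>\<^sup>k\<^sup>+\<^sup>1 Q \<epsilon> Z\<close>.\<close>
  define Z where "Z = P (?W (k - 1) 0)"
  have zero: "0 \<in> {0..<\<delta>}" using \<delta> by simp
  have Z: "Z \<in> C_space0 l" unfolding Z_def by (intro P_in W_in v0 dom zero)
  have rem: "norm (C_norm l (\<lambda>x. h \<epsilon> x - (h 0 x + (\<Sum>n=1..k. \<epsilon> ^ n / fact (n - 1) * (C_deriv l ^^ (n - 1)) R 0 x))))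
      \<le> c * (N Z / (1 - rate)) * \<epsilon> ^ Suc k" if \<epsilon>: "\<epsilon> \<in> {0..<\<delta>}" for \<epsilon>
  proof -
    note \<epsilon>' = dom[OF \<epsilon>]
    obtain m where m: "k = Suc m" using assms(1) by (cases k) auto
    have sum_apply: "(\<Sum>n\<in>A. u n) x = (\<Sum>n\<in>A. u n x)" for A and u :: "nat \<Rightarrow> real \<Rightarrow> real" and x
      by (induction A rule: infinite_finite_induct) auto
    have "h \<epsilon> x - (h 0 x + (\<Sum>n=1..k. \<epsilon> ^ n / fact (n - 1) * (C_deriv l ^^ (n - 1)) R 0 x))
        = (\<epsilon> ^ Suc k *\<^sub>R Q \<epsilon> Z) x" for x
    proof -
      have "(\<Sum>n=1..k. \<epsilon> ^ n / fact (n - 1) * (C_deriv l ^^ (n - 1)) R 0 x)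
          = (\<Sum>n\<le>m. \<epsilon> ^ Suc n / fact n * (fact n * ?W n 0 x))"
        unfolding m One_nat_def sum.shift_bounds_cl_Suc_ivl iter[OF zero] diff_Suc_1 scaleR_fun_apply
        by (simp add: atMost_atLeast0)
      also have "\<dots> = \<epsilon> * (\<Sum>n\<le>m. \<epsilon> ^ n * ?W n 0 x)"
        by (simp add: sum_distrib_left mult_ac)
      finally have sum: "(\<Sum>n=1..k. \<epsilon> ^ n / fact (n - 1) * (C_deriv l ^^ (n - 1)) R 0 x)
          = \<epsilon> * (\<Sum>n\<le>m. \<epsilon> ^ n * ?W n 0 x)" .
      have "Q \<epsilon> gauss_drift x = (\<Sum>n\<le>m. \<epsilon> ^ n * ?W n 0 x) + \<epsilon> ^ k * Q \<epsilon> Z x"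
        using fun_cong[OF W_Taylor[OF v0 dom[OF zero] \<epsilon>', of m], of x] by (simp add: sum_apply Z_def m)
      thus ?thesis unfolding sum h_0 h[OF \<epsilon>] by (simp add: algebra_simps)
    qed
    hence "norm (C_norm l (\<lambda>x. h \<epsilon> x - (h 0 x + (\<Sum>n=1..k. \<epsilon> ^ n / fact (n - 1) * (C_deriv l ^^ (n - 1)) R 0 x))))
        = norm (C_norm l (\<epsilon> ^ Suc k *\<^sub>R Q \<epsilon> Z))" by presburger
    also have "\<dots> = \<epsilon> ^ Suc k * C_norm l (Q \<epsilon> Z)"
      using C_norm_scale[OF S_C[OF Q_in[OF \<epsilon>' Z]], of "\<epsilon> ^ Suc k"]
        C_norm_nonneg[OF S_C[OF Q_in[OF \<epsilon>' Z]]] \<epsilon> by (simp add: abs_mult)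
    also have "\<dots> \<le> \<epsilon> ^ Suc k * (c * (N Z / (1 - rate)))"
      using \<epsilon> c by (intro mult_left_mono order_trans[OF le_N] Q_bound[OF \<epsilon>'] Q_in[OF \<epsilon>'] Z) auto
    finally show ?thesis by (simp only: mult.commute)
  qed
  show ?thesis
  proof (intro conjI exI[of _ \<delta>] ballI allI impI)
    show "v \<in> C_space0 l" unfolding v by (rule v0)
    show "0 < \<delta>" by (rule \<delta>)
    fix \<epsilon> assume \<epsilon>: "\<epsilon> \<in> {0..<\<delta>}"
    show "\<exists>!f. is_invariant_density l \<epsilon> f" unfolding inv[OF \<epsilon>] by simp
    show "bij_betw (I_minus_L \<epsilon>) (C_space0 l) (C_space0 l)"
      unfolding I_eq by (rule bij_I_minus_T[OF dom[OF \<epsilon>]])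
    show "\<exists>\<psi>. has_C_derivative l ((C_deriv l ^^ n) R) \<psi> \<epsilon>" for n
      using deriv[OF iter \<epsilon>] by blast
  next
    let ?r = "\<lambda>\<epsilon>. C_norm l (\<lambda>x. h \<epsilon> x -
        (h 0 x + (\<Sum>n=1..k. \<epsilon> ^ n / fact (n - 1) * (C_deriv l ^^ (n - 1)) R 0 x)))"
    have "\<forall>\<^sub>F \<epsilon> in at_right 0. \<epsilon> \<in> {0<..<\<delta>}" using \<delta> by (intro eventually_at_right_real)
    hence "\<forall>\<^sub>F \<epsilon> in at_right 0. norm (?r \<epsilon>) \<le> c * (N Z / (1 - rate)) * norm (\<epsilon> ^ Suc k)"
    proof eventually_elim
      case (elim \<epsilon>)
      thus ?case using rem[of \<epsilon>] by simp
    qed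
    hence "?r \<in> O[at_right 0](\<lambda>\<epsilon>. \<epsilon> ^ Suc k)" by (rule bigoI)
    also have "(\<lambda>\<epsilon>::real. \<epsilon> ^ Suc k) \<in> o[at_right 0](\<lambda>\<epsilon>. \<epsilon> ^ k)"
    proof (rule smalloI_tendsto)
      have nz: "\<forall>\<^sub>F \<epsilon> in at_right 0. \<epsilon> \<noteq> (0::real)" by (simp add: eventually_at_filter)
      show "\<forall>\<^sub>F \<epsilon> in at_right 0. \<epsilon> ^ k \<noteq> (0::real)" using nz by eventually_elim auto
      have "((\<lambda>\<epsilon>::real. \<epsilon>) \<longlongrightarrow> 0) (at_right 0)" by (rule tendsto_ident_at)
      thus "((\<lambda>\<epsilon>::real. \<epsilon> ^ Suc k / \<epsilon> ^ k) \<longlongrightarrow> 0) (at_right 0)"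
        by (rule Lim_transform_eventually) (use nz in eventually_elim, auto)
    qed
    finally show "?r \<in> o[at_right 0](\<lambda>\<epsilon>. \<epsilon> ^ k)" .
  qed
qed

end
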